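(* Let $(H,K,\rightharpoonup,\leftharpoonup)$ be a matched pair of Hopf algebras, let $K\bowtie H$ be its double cross product, and let $\iota_H:H\to K\bowtie H$, $x\mapsto 1_K\otimes x$. Then there exists a Hopf algebra homomorphism $\theta:K\bowtie H\to H$ such that $\theta\iota_H=\mathrm{id}_H$ if and only if there exists a Hopf algebra homomorphism $\pi:K\to H$ such that $$\pi(x_1\rightharpoonup a_1)(x_2\leftharpoonup a_2)=x\,\pi(a),\qquad\forall a\in K,\ x\in H.$$
   Context: Everything is over a fixed arbitrary field $\mathbf{k}$. Hopf algebras are $H=(H,\cdot,1_H,\Delta_H,\varepsilon_H,S_H)$, with Sweedler notation $\Delta(x)=x_1\otimes x_2$. A matched pair of Hopf algebras $(H,K,\rightharpoonup,\leftharpoonup)$ consists of Hopf algebras $H,K$, a left $H$-module coalgebra action $\rightharpoonup:H\otimes K\to K$ on $K$ and a right $K$-module coalgebra action $\leftharpoonup:H\otimes K\to H$ on $H$ (so both maps are module actions and coalgebra maps) such that for all $x,y\in H$, $a,b\in K$: $x\rightharpoonup ab=(x_1\rightharpoonup a_1)((x_2\leftharpoonup a_2)\rightharpoonup b)$; $x\rightharpoonup 1_K=\varepsilon_H(x)1_K$; $xy\leftharpoonup a=(x\leftharpoonup(y_1\rightharpoonup a_1))(y_2\leftharpoonup a_2)$; $1_H\leftharpoonup a=\varepsilon_K(a)1_H$; $(x_1\rightharpoonup a_1)\otimes(x_2\leftharpoonup a_2)=(x_2\rightharpoonup a_2)\otimes(x_1\leftharpoonup a_1)$. The double cross product $K\bowtie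 H$ is the Hopf algebra on $K\otimes H$ with product $(a\otimes x)(b\otimes y)=a(x_1\rightharpoonup b_1)\otimes(x_2\leftharpoonup b_2)y$, unit $1_K\otimes 1_H$, the tensor product coalgebra structure, and antipode $a\otimes x\mapsto (1\otimes S_H(x))(S_K(a)\otimes 1)$. *)

theory Defs
  imports "HOL-Algebra.Module" "HOL-Algebra.AbelCoset"
begin

text \<open>The library has no tensor products and only commutative algebras, so both are set up here
  for modules in the sense of HOL-Algebra. The scalars \<open>k\<close> form a field from
  \<open>unital_algebra\<close> and \<open>coalgebra\<close> onwards.\<close>

section \<open>Linear and bilinear maps\<close>

definition regular_module :: "('k, 'm) ring_scheme \<Rightarrow> ('k, 'k) module" where
  "regular_module k = \<lparr>carrier = carrier k, mult = mult k, one = \<one>\<^bsub>k\<^esub>,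
     zero = \<zero>\<^bsub>k\<^esub>, add = add k, smult = mult k\<rparr>"

definition linear_map ::
    "('k, 'm) ring_scheme \<Rightarrow> ('k, 'v, 'n) module_scheme \<Rightarrow> ('k, 'u, 'o) module_scheme
      \<Rightarrow> ('v \<Rightarrow> 'u) \<Rightarrow> bool" where
  "linear_map k V U f \<longleftrightarrow>
     f \<in> carrier V \<rightarrow> carrier U \<and>
     (\<forall>v\<in>carrier V. \<forall>v'\<in>carrier V. f (v \<oplus>\<^bsub>V\<^esub> v') = f v \<oplus>\<^bsub>U\<^esub> f v') \<and>
     (\<forall>c\<in>carrier k. \<forall>v\<in>carrier V. f (c \<odot>\<^bsub>V\<^esub> v) = c \<odot>\<^bsub>U\<^esub> f v)"

definition bilinear_map ::
    "('k, 'm) ring_scheme \<Rightarrow> ('k, 'v, 'n) module_scheme \<Rightarrow> ('k, 'w, 'o) module_scheme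
      \<Rightarrow> ('k, 'u, 'p) module_scheme \<Rightarrow> ('v \<Rightarrow> 'w \<Rightarrow> 'u) \<Rightarrow> bool" where
  "bilinear_map k V W U \<beta> \<longleftrightarrow>
     (\<forall>v\<in>carrier V. linear_map k W U (\<lambda>w. \<beta> v w)) \<and>
     (\<forall>w\<in>carrier W. linear_map k V U (\<lambda>v. \<beta> v w))"

section \<open>Tensor products\<close>

text \<open>\<open>V \<otimes> W\<close> is the free module on \<open>V \<times> W\<close> modulo the bilinearity relations. Its elements are
  cosets, and it is again a \<open>module\<close> record. The fields \<open>mult\<close> and \<open>one\<close>, which the record
  inherits from \<open>ring\<close>, are junk for a mere module.\<close>

definition free_module :: "('k, 'm) ring_scheme \<Rightarrow> 'x set \<Rightarrow> ('k, 'x \<Rightarrow> 'k) module" where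
  "free_module k X =
    \<lparr>carrier = {f. (\<forall>x\<in>X. f x \<in> carrier k) \<and> (\<forall>x. x \<notin> X \<longrightarrow> f x = \<zero>\<^bsub>k\<^esub>) \<and>
                   finite {x. f x \<noteq> \<zero>\<^bsub>k\<^esub>}},
     mult = undefined, one = undefined,
     zero = (\<lambda>x. \<zero>\<^bsub>k\<^esub>), add = (\<lambda>f g x. f x \<oplus>\<^bsub>k\<^esub> g x), smult = (\<lambda>c f x. c \<otimes>\<^bsub>k\<^esub> f x)\<rparr>"

definition free_gen :: "('k, 'm) ring_scheme \<Rightarrow> 'x \<Rightarrow> 'x \<Rightarrow> 'k" where
  "free_gen k x = (\<lambda>y. if y = x then \<one>\<^bsub>k\<^esub> else \<zero>\<^bsub>k\<^esub>)"

definition free_pairs ::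
    "('k, 'm) ring_scheme \<Rightarrow> ('k, 'v, 'n) module_scheme \<Rightarrow> ('k, 'w, 'o) module_scheme
      \<Rightarrow> ('k, 'v \<times> 'w \<Rightarrow> 'k) module" where
  "free_pairs k V W = free_module k (carrier V \<times> carrier W)"

definition bilinearity_relations ::
    "('k, 'm) ring_scheme \<Rightarrow> ('k, 'v, 'n) module_scheme \<Rightarrow> ('k, 'w, 'o) module_scheme
      \<Rightarrow> ('v \<times> 'w \<Rightarrow> 'k) set" where
  "bilinearity_relations k V W =
    (let F = free_pairs k V W; g = (\<lambda>v w. free_gen k (v, w)) in
      {g (v \<oplus>\<^bsub>V\<^esub> v') w \<ominus>\<^bsub>F\<^esub> (g v w \<oplus>\<^bsub>F\<^esub> g v' w) | v v' w.
         v \<in> carrier V \<and> v' \<in> carrier V \<and> w \<in> carrier W}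
    \<union> {g v (w \<oplus>\<^bsub>W\<^esub> w') \<ominus>\<^bsub>F\<^esub> (g v w \<oplus>\<^bsub>F\<^esub> g v w') | v w w'.
         v \<in> carrier V \<and> w \<in> carrier W \<and> w' \<in> carrier W}
    \<union> {g (c \<odot>\<^bsub>V\<^esub> v) w \<ominus>\<^bsub>F\<^esub> (c \<odot>\<^bsub>F\<^esub> g v w) | c v w.
         c \<in> carrier k \<and> v \<in> carrier V \<and> w \<in> carrier W}
    \<union> {g v (c \<odot>\<^bsub>W\<^esub> w) \<ominus>\<^bsub>F\<^esub> (c \<odot>\<^bsub>F\<^esub> g v w) | c v w.
         c \<in> carrier k \<and> v \<in> carrier V \<and> w \<in> carrier W})"

definition tensor_kernel ::
    "('k, 'm) ring_scheme \<Rightarrow> ('k, 'v, 'n) module_scheme \<Rightarrow> ('k, 'w, 'o) module_scheme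
      \<Rightarrow> ('v \<times> 'w \<Rightarrow> 'k) set" where
  "tensor_kernel k V W =
     \<Inter>{N. submodule N k (free_pairs k V W) \<and> bilinearity_relations k V W \<subseteq> N}"

definition tensor ::
    "('k, 'm) ring_scheme \<Rightarrow> ('k, 'v, 'n) module_scheme \<Rightarrow> ('k, 'w, 'o) module_scheme
      \<Rightarrow> ('k, ('v \<times> 'w \<Rightarrow> 'k) set) module" where
  "tensor k V W =
    (let F = free_pairs k V W; N = tensor_kernel k V W in
      \<lparr>carrier = a_rcosets\<^bsub>F\<^esub> N, mult = undefined, one = undefined,
       zero = N, add = set_add F, smult = (\<lambda>c C. \<Union>f\<in>C. N +>\<^bsub>F\<^esub> (c \<odot>\<^bsub>F\<^esub> f))\<rparr>)"

definition pure_tensor ::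
    "('k, 'm) ring_scheme \<Rightarrow> ('k, 'v, 'n) module_scheme \<Rightarrow> ('k, 'w, 'o) module_scheme
      \<Rightarrow> 'v \<Rightarrow> 'w \<Rightarrow> ('v \<times> 'w \<Rightarrow> 'k) set" where
  "pure_tensor k V W v w = tensor_kernel k V W +>\<^bsub>free_pairs k V W\<^esub> free_gen k (v, w)"

text \<open>The linear map \<open>V \<otimes> W \<rightarrow> U\<close>, \<open>v \<otimes> w \<mapsto> \<beta> v w\<close> induced by a bilinear \<open>\<beta>\<close>: the common value on
  the coset \<open>t\<close> of the linear extension of \<open>\<beta>\<close> to the free module.\<close>

definition tensor_lift ::
    "('k, 'm) ring_scheme \<Rightarrow> ('k, 'u, 'n) module_scheme \<Rightarrow> ('v \<Rightarrow> 'w \<Rightarrow> 'u)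
      \<Rightarrow> ('v \<times> 'w \<Rightarrow> 'k) set \<Rightarrow> 'u" where
  "tensor_lift k U \<beta> t =
     the_elem ((\<lambda>f. \<Oplus>\<^bsub>U\<^esub>p\<in>{p. f p \<noteq> \<zero>\<^bsub>k\<^esub>}. f p \<odot>\<^bsub>U\<^esub> \<beta> (fst p) (snd p)) ` t)"

section \<open>Algebras, coalgebras, Hopf algebras\<close>

locale unital_algebra =
  field k + module k A + ring A for k (structure) and A (structure) +
  assumes smult_mult_left:
      "\<lbrakk>c \<in> carrier k; x \<in> carrier A; y \<in> carrier A\<rbrakk>
        \<Longrightarrow> (c \<odot>\<^bsub>A\<^esub> x) \<otimes>\<^bsub>A\<^esub> y = c \<odot>\<^bsub>A\<^esub> (x \<otimes>\<^bsub>A\<^esub> y)"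
    and smult_mult_right:
      "\<lbrakk>c \<in> carrier k; x \<in> carrier A; y \<in> carrier A\<rbrakk>
        \<Longrightarrow> x \<otimes>\<^bsub>A\<^esub> (c \<odot>\<^bsub>A\<^esub> y) = c \<odot>\<^bsub>A\<^esub> (x \<otimes>\<^bsub>A\<^esub> y)"

record ('k, 'a) coalgebra = "('k, 'a) module" +
  comult :: "'a \<Rightarrow> ('a \<times> 'a \<Rightarrow> 'k) set"
  counit :: "'a \<Rightarrow> 'k"

record ('k, 'a) hopf_algebra = "('k, 'a) coalgebra" +
  antipode :: "'a \<Rightarrow> 'a"

text \<open>Sweedler notation: \<open>sweedler k C x U (\<lambda>x1 x2. \<beta> x1 x2)\<close> is the element written
  \<open>\<beta> x\<^sub>1 x\<^sub>2\<close> of \<open>U\<close>, where \<open>\<Delta> x = x\<^sub>1 \<otimes> x\<^sub>2\<close> and \<open>\<beta>\<close> is bilinear. Two independent Sweedler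
  sums are expressed by nesting.\<close>

definition sweedler ::
    "('k, 'm) ring_scheme \<Rightarrow> ('k, 'a, 'n) coalgebra_scheme \<Rightarrow> 'a \<Rightarrow> ('k, 'u, 'o) module_scheme
      \<Rightarrow> ('a \<Rightarrow> 'a \<Rightarrow> 'u) \<Rightarrow> 'u" where
  "sweedler k C x U \<beta> = tensor_lift k U \<beta> (comult C x)"

locale coalgebra =
  field k + module k C for k (structure) and C (structure) +
  assumes comult_linear: "linear_map k C (tensor k C C) (comult C)"
    and counit_linear: "linear_map k C (regular_module k) (counit C)"
    and coassoc: "x \<in> carrier C \<Longrightarrow>
      sweedler k C x (tensor k C (tensor k C C)) (\<lambda>x1 x2.
        sweedler k C x1 (tensor k C (tensor k C C)) (\<lambda>x11 x12.
          pure_tensor k C (tensor k C C) x11 (pure_tensor k C C x12 x2))) =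
      sweedler k C x (tensor k C (tensor k C C)) (\<lambda>x1 x2.
        sweedler k C x2 (tensor k C (tensor k C C)) (\<lambda>x21 x22.
          pure_tensor k C (tensor k C C) x1 (pure_tensor k C C x21 x22)))"
    and counit_left: "x \<in> carrier C \<Longrightarrow> sweedler k C x C (\<lambda>x1 x2. counit C x1 \<odot>\<^bsub>C\<^esub> x2) = x"
    and counit_right: "x \<in> carrier C \<Longrightarrow> sweedler k C x C (\<lambda>x1 x2. counit C x2 \<odot>\<^bsub>C\<^esub> x1) = x"

locale hopf_algebra =
  unital_algebra k H + coalgebra k H for k (structure) and H (structure) +
  assumes comult_one: "comult H \<one>\<^bsub>H\<^esub> = pure_tensor k H H \<one>\<^bsub>H\<^esub> \<one>\<^bsub>H\<^esub>"
    and comult_mult: "\<lbrakk>x \<in> carrier H; y \<in> carrier H\<rbrakk> \<Longrightarrow>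
      comult H (x \<otimes>\<^bsub>H\<^esub> y) =
        sweedler k H x (tensor k H H) (\<lambda>x1 x2. sweedler k H y (tensor k H H) (\<lambda>y1 y2.
          pure_tensor k H H (x1 \<otimes>\<^bsub>H\<^esub> y1) (x2 \<otimes>\<^bsub>H\<^esub> y2)))"
    and counit_ring_hom: "counit H \<in> ring_hom H k"
    and antipode_linear: "linear_map k H H (antipode H)"
    and antipode_left: "x \<in> carrier H \<Longrightarrow>
      sweedler k H x H (\<lambda>x1 x2. antipode H x1 \<otimes>\<^bsub>H\<^esub> x2) = counit H x \<odot>\<^bsub>H\<^esub> \<one>\<^bsub>H\<^esub>"
    and antipode_right: "x \<in> carrier H \<Longrightarrow>
      sweedler k H x H (\<lambda>x1 x2. x1 \<otimes>\<^bsub>H\<^esub> antipode H x2) = counit H x \<odot>\<^bsub>H\<^esub> \<one>\<^bsub>H\<^esub>"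

definition coalgebra_hom ::
    "('k, 'm) ring_scheme \<Rightarrow> ('k, 'a, 'n) coalgebra_scheme \<Rightarrow> ('k, 'b, 'o) coalgebra_scheme
      \<Rightarrow> ('a \<Rightarrow> 'b) \<Rightarrow> bool" where
  "coalgebra_hom k C D f \<longleftrightarrow>
     linear_map k C D f \<and>
     (\<forall>x\<in>carrier C. comult D (f x) =
        sweedler k C x (tensor k D D) (\<lambda>x1 x2. pure_tensor k D D (f x1) (f x2))) \<and>
     (\<forall>x\<in>carrier C. counit D (f x) = counit C x)"

text \<open>Compatibility with the antipodes is automatic for a bialgebra map between Hopf algebras;
  it is part of the definition here so that the whole structure is visibly preserved.\<close>

definition hopf_hom ::
    "('k, 'm) ring_scheme \<Rightarrow> ('k, 'a, 'n) hopf_algebra_scheme \<Rightarrow> ('k, 'b, 'o) hopf_algebra_scheme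
      \<Rightarrow> ('a \<Rightarrow> 'b) \<Rightarrow> bool" where
  "hopf_hom k A B f \<longleftrightarrow>
     f \<in> ring_hom A B \<and> coalgebra_hom k A B f \<and>
     (\<forall>x\<in>carrier A. f (antipode A x) = antipode B (f x))"

definition tensor_coalgebra ::
    "('k, 'm) ring_scheme \<Rightarrow> ('k, 'v, 'n) coalgebra_scheme \<Rightarrow> ('k, 'w, 'o) coalgebra_scheme
      \<Rightarrow> ('k, ('v \<times> 'w \<Rightarrow> 'k) set) coalgebra" where
  "tensor_coalgebra k V W =
    (let T = tensor k V W; TT = tensor k T T in
      module.extend T \<lparr>
       comult = tensor_lift k TT (\<lambda>v w. sweedler k V v TT (\<lambda>v1 v2. sweedler k W w TT (\<lambda>w1 w2.
         pure_tensor k T T (pure_tensor k V W v1 w1) (pure_tensor k V W v2 w2)))),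
       counit = tensor_lift k (regular_module k) (\<lambda>v w. counit V v \<otimes>\<^bsub>k\<^esub> counit W w)\<rparr>)"

section \<open>Matched pairs and the double cross product\<close>

definition left_module_coalgebra ::
    "('k, 'm) ring_scheme \<Rightarrow> ('k, 'h, 'n) hopf_algebra_scheme \<Rightarrow> ('k, 'a, 'o) coalgebra_scheme
      \<Rightarrow> ('h \<Rightarrow> 'a \<Rightarrow> 'a) \<Rightarrow> bool" where
  "left_module_coalgebra k H C act \<longleftrightarrow>
     bilinear_map k H C C act \<and>
     (\<forall>c\<in>carrier C. act \<one>\<^bsub>H\<^esub> c = c) \<and>
     (\<forall>x\<in>carrier H. \<forall>y\<in>carrier H. \<forall>c\<in>carrier C. act (x \<otimes>\<^bsub>H\<^esub> y) c = act x (act y c)) \<and>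
     coalgebra_hom k (tensor_coalgebra k H C) C (tensor_lift k C act)"

definition right_module_coalgebra ::
    "('k, 'm) ring_scheme \<Rightarrow> ('k, 'h, 'n) hopf_algebra_scheme \<Rightarrow> ('k, 'a, 'o) coalgebra_scheme
      \<Rightarrow> ('a \<Rightarrow> 'h \<Rightarrow> 'a) \<Rightarrow> bool" where
  "right_module_coalgebra k H C act \<longleftrightarrow>
     bilinear_map k C H C act \<and>
     (\<forall>c\<in>carrier C. act c \<one>\<^bsub>H\<^esub> = c) \<and>
     (\<forall>c\<in>carrier C. \<forall>x\<in>carrier H. \<forall>y\<in>carrier H. act c (x \<otimes>\<^bsub>H\<^esub> y) = act (act c x) y) \<and>
     coalgebra_hom k (tensor_coalgebra k C H) C (tensor_lift k C act)"

locale matched_pair =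
  H: hopf_algebra k H + K: hopf_algebra k K
  for k (structure) and H (structure) and K (structure) +
  fixes lact :: "'h \<Rightarrow> 'a \<Rightarrow> 'a" (infixr \<open>\<rightharpoonup>\<close> 75)
    and ract :: "'h \<Rightarrow> 'a \<Rightarrow> 'h" (infixl \<open>\<leftharpoonup>\<close> 75)
  assumes lact_module_coalgebra: "left_module_coalgebra k H K lact"
    and ract_module_coalgebra: "right_module_coalgebra k K H ract"
    and lact_mult: "\<lbrakk>x \<in> carrier H; a \<in> carrier K; b \<in> carrier K\<rbrakk> \<Longrightarrow>
      x \<rightharpoonup> (a \<otimes>\<^bsub>K\<^esub> b) =
        sweedler k H x K (\<lambda>x1 x2. sweedler k K a K (\<lambda>a1 a2.
          (x1 \<rightharpoonup> a1) \<otimes>\<^bsub>K\<^esub> ((x2 \<leftharpoonup> a2) \<rightharpoonup> b)))"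
    and lact_one: "x \<in> carrier H \<Longrightarrow> x \<rightharpoonup> \<one>\<^bsub>K\<^esub> = counit H x \<odot>\<^bsub>K\<^esub> \<one>\<^bsub>K\<^esub>"
    and ract_mult: "\<lbrakk>x \<in> carrier H; y \<in> carrier H; a \<in> carrier K\<rbrakk> \<Longrightarrow>
      (x \<otimes>\<^bsub>H\<^esub> y) \<leftharpoonup> a =
        sweedler k H y H (\<lambda>y1 y2. sweedler k K a H (\<lambda>a1 a2.
          (x \<leftharpoonup> (y1 \<rightharpoonup> a1)) \<otimes>\<^bsub>H\<^esub> (y2 \<leftharpoonup> a2)))"
    and ract_one: "a \<in> carrier K \<Longrightarrow> \<one>\<^bsub>H\<^esub> \<leftharpoonup> a = counit K a \<odot>\<^bsub>H\<^esub> \<one>\<^bsub>H\<^esub>"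
    and lact_ract_swap: "\<lbrakk>x \<in> carrier H; a \<in> carrier K\<rbrakk> \<Longrightarrow>
      sweedler k H x (tensor k K H) (\<lambda>x1 x2. sweedler k K a (tensor k K H) (\<lambda>a1 a2.
        pure_tensor k K H (x1 \<rightharpoonup> a1) (x2 \<leftharpoonup> a2))) =
      sweedler k H x (tensor k K H) (\<lambda>x1 x2. sweedler k K a (tensor k K H) (\<lambda>a1 a2.
        pure_tensor k K H (x2 \<rightharpoonup> a2) (x1 \<leftharpoonup> a1)))"

definition double_cross_mult ::
    "('k, 'm) ring_scheme \<Rightarrow> ('k, 'h, 'n) hopf_algebra_scheme \<Rightarrow> ('k, 'a, 'o) hopf_algebra_scheme
      \<Rightarrow> ('h \<Rightarrow> 'a \<Rightarrow> 'a) \<Rightarrow> ('h \<Rightarrow> 'a \<Rightarrow> 'h)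
      \<Rightarrow> ('a \<times> 'h \<Rightarrow> 'k) set \<Rightarrow> ('a \<times> 'h \<Rightarrow> 'k) set \<Rightarrow> ('a \<times> 'h \<Rightarrow> 'k) set" where
  "double_cross_mult k H K lact ract s t =
    (let T = tensor k K H in
      tensor_lift k T (\<lambda>a x. tensor_lift k T (\<lambda>b y.
        sweedler k H x T (\<lambda>x1 x2. sweedler k K b T (\<lambda>b1 b2.
          pure_tensor k K H (a \<otimes>\<^bsub>K\<^esub> lact x1 b1) (ract x2 b2 \<otimes>\<^bsub>H\<^esub> y)))) t) s)"

definition double_cross_product ::
    "('k, 'm) ring_scheme \<Rightarrow> ('k, 'h, 'n) hopf_algebra_scheme \<Rightarrow> ('k, 'a, 'o) hopf_algebra_scheme
      \<Rightarrow> ('h \<Rightarrow> 'a \<Rightarrow> 'a) \<Rightarrow> ('h \<Rightarrow> 'a \<Rightarrow> 'h)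
      \<Rightarrow> ('k, ('a \<times> 'h \<Rightarrow> 'k) set) hopf_algebra" where
  "double_cross_product k H K lact ract =
    (let T = tensor_coalgebra k K H in
      coalgebra.extend
        (T\<lparr>mult := double_cross_mult k H K lact ract,
           one := pure_tensor k K H \<one>\<^bsub>K\<^esub> \<one>\<^bsub>H\<^esub>\<rparr>)
        \<lparr>antipode = tensor_lift k T (\<lambda>a x.
           double_cross_mult k H K lact ract
             (pure_tensor k K H \<one>\<^bsub>K\<^esub> (antipode H x))
             (pure_tensor k K H (antipode K a) \<one>\<^bsub>H\<^esub>))\<rparr>)"

definition double_cross_inclusion ::
    "('k, 'm) ring_scheme \<Rightarrow> ('k, 'h, 'n) hopf_algebra_scheme \<Rightarrow> ('k, 'a, 'o) hopf_algebra_scheme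
      \<Rightarrow> 'h \<Rightarrow> ('a \<times> 'h \<Rightarrow> 'k) set" where
  "double_cross_inclusion k H K x = pure_tensor k K H \<one>\<^bsub>K\<^esub> x"

end

theory Submission
  imports Defs
begin

text \<open>A retraction \<open>\<theta>\<close> of \<open>\<iota>\<^sub>H\<close> is determined by \<open>\<pi> a = \<theta> (a \<otimes> 1)\<close>, since
  \<open>a \<otimes> x = (a \<otimes> 1) (1 \<otimes> x)\<close> forces \<open>\<theta> (a \<otimes> x) = \<pi> a x\<close>. The compatibility condition on \<open>\<pi>\<close> is the image
  under \<open>\<theta>\<close> of \<open>(1 \<otimes> x) (a \<otimes> 1) = (x\<^sub>1 \<rightharpoonup> a\<^sub>1) \<otimes> (x\<^sub>2 \<leftharpoonup> a\<^sub>2)\<close>, and it is exactly what makes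
  \<open>a \<otimes> x \<mapsto> \<pi> a x\<close> multiplicative. That the latter map respects the antipodes rests on
  \<open>S (x y) = S y S x\<close> in \<open>H\<close>.\<close>

section \<open>Linear maps\<close>

text \<open>A Sweedler expression is a value of \<open>tensor_lift\<close>, that is,
  \<open>the_elem\<close> of the image of a coset. It obeys no law until its integrand is known to
  be bilinear on the carriers. Every textbook equality therefore comes with a bilinearity
  obligation. For this reason linearity facts are stated as closure rules that \<open>intro\<close>
  can chain, and rewriting under a sum uses congruence rules restricted to carriers.

  The antipode of the double cross product sends \<open>a \<otimes> x\<close> to
  \<open>(1 \<otimes> S x) (S a \<otimes> 1)\<close>, whose image under \<open>\<theta>\<close> is
  \<open>S x \<cdot> \<pi> (S a) = S x \<cdot> S (\<pi> a)\<close>. This has to equal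
  \<open>S (\<pi> a \<cdot> x)\<close>, so the order reversal by \<open>S\<close> is needed, and it
  is not among the Hopf algebra axioms. The usual source is uniqueness of inverses in the
  convolution algebra of maps from \<open>H \<otimes> H\<close> to \<open>H\<close>. Here that
  argument is unrolled into Sweedler sums: antipode factors are inserted through the counit and
  cancelled after regrouping by coassociativity.\<close>

lemma linear_mapI:
  assumes "\<And>v. v \<in> carrier V \<Longrightarrow> f v \<in> carrier U"
    and "\<And>v w. v \<in> carrier V \<Longrightarrow> w \<in> carrier V \<Longrightarrow> f (v \<oplus>\<^bsub>V\<^esub> w) = f v \<oplus>\<^bsub>U\<^esub> f w"
    and "\<And>c v. c \<in> carrier k \<Longrightarrow> v \<in> carrier V \<Longrightarrow> f (c \<odot>\<^bsub>V\<^esub> v) = c \<odot>\<^bsub>U\<^esub> f v"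
  shows "linear_map k V U f"
  using assms by (auto simp: linear_map_def)

lemma linear_map_closed: "linear_map k V U f \<Longrightarrow> v \<in> carrier V \<Longrightarrow> f v \<in> carrier U"
  and linear_map_add: "linear_map k V U f \<Longrightarrow> v \<in> carrier V \<Longrightarrow> w \<in> carrier V
    \<Longrightarrow> f (v \<oplus>\<^bsub>V\<^esub> w) = f v \<oplus>\<^bsub>U\<^esub> f w"
  and linear_map_smult: "linear_map k V U f \<Longrightarrow> c \<in> carrier k \<Longrightarrow> v \<in> carrier V
    \<Longrightarrow> f (c \<odot>\<^bsub>V\<^esub> v) = c \<odot>\<^bsub>U\<^esub> f v"
  by (auto simp: linear_map_def)

lemma linear_map_zero:
  assumes "module k V" "module k U" "linear_map k V U f"
  shows "f \<zero>\<^bsub>V\<^esub> = \<zero>\<^bsub>U\<^esub>"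
proof -
  interpret V: module k V by fact
  interpret U: module k U by fact
  have "f (\<zero>\<^bsub>k\<^esub> \<odot>\<^bsub>V\<^esub> \<zero>\<^bsub>V\<^esub>) = \<zero>\<^bsub>k\<^esub> \<odot>\<^bsub>U\<^esub> f \<zero>\<^bsub>V\<^esub>"
    by (intro linear_map_smult[OF assms(3)]) auto
  then show ?thesis using linear_map_closed[OF assms(3)] by simp
qed

lemma linear_map_a_inv:
  assumes "module k V" "module k U" "linear_map k V U f" "v \<in> carrier V"
  shows "f (\<ominus>\<^bsub>V\<^esub> v) = \<ominus>\<^bsub>U\<^esub> f v"
proof -
  interpret V: module k V by fact
  interpret U: module k U by fact
  have fv: "f v \<in> carrier U" "f (\<ominus>\<^bsub>V\<^esub> v) \<in> carrier U"
    using linear_map_closed[OF assms(3)] assms(4) by auto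
  have "f (\<ominus>\<^bsub>V\<^esub> v) \<oplus>\<^bsub>U\<^esub> f v = f (\<ominus>\<^bsub>V\<^esub> v \<oplus>\<^bsub>V\<^esub> v)"
    using assms(4) by (simp add: linear_map_add[OF assms(3)])
  also have "\<dots> = \<zero>\<^bsub>U\<^esub>" using assms linear_map_zero by (simp add: V.M.l_neg)
  finally show ?thesis using fv by (metis U.M.minus_equality)
qed

lemma submodule_kernel:
  assumes "module k V" "module k U" "linear_map k V U f"
  shows "submodule {v \<in> carrier V. f v = \<zero>\<^bsub>U\<^esub>} k V"
proof -
  interpret V: module k V by fact
  interpret U: module k U by fact
  show ?thesis
    using assms
    by (intro V.submoduleI)
      (auto simp: linear_map_add linear_map_smult linear_map_zero linear_map_a_inv)
qed

lemma linear_map_ident: "linear_map k V V (\<lambda>v. v)"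
  by (auto intro: linear_mapI)

lemma linear_map_comp:
  assumes "linear_map k V U f" "linear_map k U X g"
  shows "linear_map k V X (\<lambda>v. g (f v))"
  using assms by (auto simp: linear_map_def Pi_def)

text \<open>Maps are total functions with arbitrary values off the carrier, so equations between
  them hold only on carriers. The module axioms enter because sums and multiples of arguments must
  stay in the range of agreement.\<close>

lemma linear_map_cong:
  assumes "\<And>v. v \<in> carrier V \<Longrightarrow> f v = g v" "module k V"
  shows "linear_map k V U f \<longleftrightarrow> linear_map k V U g"
proof -
  interpret V: module k V by fact
  show ?thesis using assms(1) by (auto simp: linear_map_def Pi_def)
qed

lemma bilinear_map_linear:
  assumes "bilinear_map k V W U \<beta>"
  shows bilinear_map_left: "w \<in> carrier W \<Longrightarrow> linear_map k V U (\<lambda>v. \<beta> v w)"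
    and bilinear_map_right: "v \<in> carrier V \<Longrightarrow> linear_map k W U (\<beta> v)"
  using assms by (auto simp: bilinear_map_def)

lemma bilinear_mapI:
  assumes "\<And>v. v \<in> carrier V \<Longrightarrow> linear_map k W U (\<beta> v)"
    and "\<And>w. w \<in> carrier W \<Longrightarrow> linear_map k V U (\<lambda>v. \<beta> v w)"
  shows "bilinear_map k V W U \<beta>"
  using assms by (auto simp: bilinear_map_def)

section \<open>Free modules\<close>

lemma carrier_free_module:
  "f \<in> carrier (free_module k X) \<longleftrightarrow> (\<forall>x\<in>X. f x \<in> carrier k) \<and> (\<forall>x. x \<notin> X \<longrightarrow> f x = \<zero>\<^bsub>k\<^esub>) \<and>
    finite {x. f x \<noteq> \<zero>\<^bsub>k\<^esub>}"
  by (simp add: free_module_def)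

lemma free_module_simps [simp]:
  "\<zero>\<^bsub>free_module k X\<^esub> = (\<lambda>x. \<zero>\<^bsub>k\<^esub>)"
  "f \<oplus>\<^bsub>free_module k X\<^esub> g = (\<lambda>x. f x \<oplus>\<^bsub>k\<^esub> g x)"
  "c \<odot>\<^bsub>free_module k X\<^esub> f = (\<lambda>x. c \<otimes>\<^bsub>k\<^esub> f x)"
  by (simp_all add: free_module_def)

context cring
begin

lemma free_module_closed: "f \<in> carrier (free_module R X) \<Longrightarrow> f x \<in> carrier R"
  by (cases "x \<in> X") (auto simp: carrier_free_module)

lemma free_module_add_closed:
  assumes "f \<in> carrier (free_module R X)" "g \<in> carrier (free_module R X)"
  shows "(\<lambda>x. f x \<oplus> g x) \<in> carrier (free_module R X)"
proof -
  have "{x. f x \<oplus> g x \<noteq> \<zero>} \<subseteq> {x. f x \<noteq> \<zero>} \<union> {x. g x \<noteq> \<zero>}" by auto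
  then have "finite {x. f x \<oplus> g x \<noteq> \<zero>}"
    by (rule finite_subset) (use assms in \<open>auto simp: carrier_free_module\<close>)
  then show ?thesis using assms by (auto simp: carrier_free_module)
qed

lemma free_module_smult_closed:
  assumes "c \<in> carrier R" "f \<in> carrier (free_module R X)"
  shows "(\<lambda>x. c \<otimes> f x) \<in> carrier (free_module R X)"
proof -
  have "{x. c \<otimes> f x \<noteq> \<zero>} \<subseteq> {x. f x \<noteq> \<zero>}" using assms by auto
  then have "finite {x. c \<otimes> f x \<noteq> \<zero>}"
    by (rule finite_subset) (use assms in \<open>auto simp: carrier_free_module\<close>)
  then show ?thesis using assms by (auto simp: carrier_free_module)
qed

lemma module_free_module: "module R (free_module R X)"
proof (rule moduleI)
  show "abelian_group (free_module R X)"
  proof (rule abelian_groupI)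
    fix f assume f: "f \<in> carrier (free_module R X)"
    \<comment> \<open>Writing the inverse as the multiple by \<open>-1\<close> reduces finiteness of
      its support to closure under scalars.\<close>
    have "(\<lambda>x. \<ominus> \<one> \<otimes> f x) \<in> carrier (free_module R X)"
      using f by (intro free_module_smult_closed) auto
    moreover have "(\<lambda>x. \<ominus> \<one> \<otimes> f x) \<oplus>\<^bsub>free_module R X\<^esub> f = \<zero>\<^bsub>free_module R X\<^esub>"
      using free_module_closed[OF f] by (auto simp: fun_eq_iff l_minus l_neg)
    ultimately show "\<exists>g\<in>carrier (free_module R X). g \<oplus>\<^bsub>free_module R X\<^esub> f = \<zero>\<^bsub>free_module R X\<^esub>"
      by blast
  qed (use free_module_add_closed[of _ X] in
      \<open>auto simp: free_module_closed a_ac fun_eq_iff carrier_free_module[of "\<lambda>x. \<zero>"]\<close>)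
qed (auto simp: is_cring free_module_smult_closed free_module_closed l_distr r_distr m_assoc)

lemma free_gen_closed: "x \<in> X \<Longrightarrow> free_gen R x \<in> carrier (free_module R X)"
  by (auto simp: carrier_free_module free_gen_def)

text \<open>Induction runs over a finite set containing the support, not over the support itself, so
  that removing a point where \<open>f\<close> already vanishes needs no separate
  bookkeeping.\<close>

lemma free_module_induct [consumes 1, case_names zero gen add]:
  assumes "f \<in> carrier (free_module R X)"
    and zero: "P (\<lambda>x. \<zero>)"
    and gen: "\<And>c x. c \<in> carrier R \<Longrightarrow> x \<in> X \<Longrightarrow> P (\<lambda>y. c \<otimes> free_gen R x y)"
    and add: "\<And>f g. f \<in> carrier (free_module R X) \<Longrightarrow> g \<in> carrier (free_module R X) \<Longrightarrow>
        P f \<Longrightarrow> P g \<Longrightarrow> P (\<lambda>x. f x \<oplus> g x)"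
  shows "P f"
proof -
  have "finite {x. f x \<noteq> \<zero>}" using assms(1) by (simp add: carrier_free_module)
  then obtain A where "finite A" "{x. f x \<noteq> \<zero>} \<subseteq> A" by blast
  then show ?thesis
    using assms(1)
  proof (induction A arbitrary: f rule: finite_induct)
    case empty
    then have "f = (\<lambda>x. \<zero>)" by auto
    then show ?case using zero by simp
  next
    case (insert x A f)
    show ?case
    proof (cases "x \<in> X")
      case False
      then have "{x. f x \<noteq> \<zero>} \<subseteq> A" using insert.prems by (auto simp: carrier_free_module)
      then show ?thesis using insert by blast
    next
      case True
      note fc = free_module_closed[OF insert.prems(2)]
      \<comment> \<open>Split \<open>f\<close> into its part at \<open>x\<close>, a multiple of a
        generator, and a rest whose support lies in \<open>A\<close>.\<close>
      let ?g = "\<lambda>y. f x \<otimes> free_gen R x y" and ?h = "f(x := \<zero>)"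
      have "{y. ?h y \<noteq> \<zero>} \<subseteq> A" using insert.prems by auto
      moreover from this have h: "?h \<in> carrier (free_module R X)"
        using insert finite_subset[of "{y. ?h y \<noteq> \<zero>}" A] by (auto simp: carrier_free_module)
      ultimately have "P ?h" by (rule insert.IH)
      then have "P (\<lambda>y. ?g y \<oplus> ?h y)"
        using h True fc by (intro add gen free_module_smult_closed free_gen_closed)
      also have "(\<lambda>y. ?g y \<oplus> ?h y) = f" using fc by (auto simp: free_gen_def)
      finally show ?thesis .
    qed
  qed
qed

end

text \<open>This is the sum that \<open>tensor_lift\<close> applies to each representative of a
  coset, isolated so that the universal property of the free module can be proved before passing to
  the quotient.\<close>

definition linear_extension ::
    "('k, 'm) ring_scheme \<Rightarrow> ('k, 'u, 'n) module_scheme \<Rightarrow> ('x \<Rightarrow> 'u) \<Rightarrow> ('x \<Rightarrow> 'k) \<Rightarrow> 'u" where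
  "linear_extension k U b f = (\<Oplus>\<^bsub>U\<^esub>x\<in>{x. f x \<noteq> \<zero>\<^bsub>k\<^esub>}. f x \<odot>\<^bsub>U\<^esub> b x)"

context module
begin

context
  fixes X and b
  assumes b: "\<And>x. x \<in> X \<Longrightarrow> b x \<in> carrier M"
begin

text \<open>The supports of \<open>f\<close>, \<open>g\<close>, their sum and their multiples
  differ. Additivity needs all the sums over one common index set, and the added terms
  vanish.\<close>

lemma linear_extension_superset:
  assumes "f \<in> carrier (free_module R X)" "finite A" "{x. f x \<noteq> \<zero>} \<subseteq> A" "A \<subseteq> X"
  shows "linear_extension R M b f = (\<Oplus>\<^bsub>M\<^esub>x\<in>A. f x \<odot>\<^bsub>M\<^esub> b x)"
  unfolding linear_extension_def
  using assms b by (intro M.add.finprod_mono_neutral_cong_left) (auto simp: free_module_closed)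

lemma linear_extension_gen:
  assumes "x \<in> X"
  shows "linear_extension R M b (free_gen R x) = b x"
proof -
  have "linear_extension R M b (free_gen R x) = (\<Oplus>\<^bsub>M\<^esub>y\<in>{x}. free_gen R x y \<odot>\<^bsub>M\<^esub> b y)"
    using assms by (intro linear_extension_superset free_gen_closed) (auto simp: free_gen_def)
  then show ?thesis using assms b by (simp add: free_gen_def)
qed

lemma linear_map_linear_extension:
  "linear_map R (free_module R X) M (linear_extension R M b)"
proof (rule linear_mapI)
  let ?s = "\<lambda>f. {x. f x \<noteq> \<zero>}"
  fix f assume f: "f \<in> carrier (free_module R X)"
  then have sf: "?s f \<subseteq> X" "finite (?s f)" by (auto simp: carrier_free_module)
  then show "linear_extension R M b f \<in> carrier M"
    using f b unfolding linear_extension_def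
    by (intro M.finsum_closed) (auto simp: free_module_closed)
  {
    fix c assume c: "c \<in> carrier R"
    have "linear_extension R M b (\<lambda>x. c \<otimes> f x) = (\<Oplus>\<^bsub>M\<^esub>x\<in>?s f. (c \<otimes> f x) \<odot>\<^bsub>M\<^esub> b x)"
      using sf c f by (intro linear_extension_superset free_module_smult_closed) auto
    also have "\<dots> = (\<Oplus>\<^bsub>M\<^esub>x\<in>?s f. c \<odot>\<^bsub>M\<^esub> (f x \<odot>\<^bsub>M\<^esub> b x))"
      using sf c f b by (intro M.finsum_cong') (auto simp: free_module_closed smult_assoc1)
    also have "\<dots> = c \<odot>\<^bsub>M\<^esub> linear_extension R M b f"
      unfolding linear_extension_def using sf c f b
      by (intro finsum_smult_ldistr[symmetric]) (auto simp: free_module_closed)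
    finally show "linear_extension R M b (c \<odot>\<^bsub>free_module R X\<^esub> f) = c \<odot>\<^bsub>M\<^esub> linear_extension R M b f"
      by simp
  }
  fix g assume g: "g \<in> carrier (free_module R X)"
  then have sg: "?s g \<subseteq> X" "finite (?s g)" by (auto simp: carrier_free_module)
  let ?A = "?s f \<union> ?s g"
  have "linear_extension R M b (\<lambda>x. f x \<oplus> g x) = (\<Oplus>\<^bsub>M\<^esub>x\<in>?A. (f x \<oplus> g x) \<odot>\<^bsub>M\<^esub> b x)"
    using sf sg f g by (intro linear_extension_superset free_module_add_closed) auto
  also have "\<dots> = (\<Oplus>\<^bsub>M\<^esub>x\<in>?A. f x \<odot>\<^bsub>M\<^esub> b x \<oplus>\<^bsub>M\<^esub> g x \<odot>\<^bsub>M\<^esub> b x)"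
    using sf sg f g b
    by (intro M.finsum_cong') (auto simp: free_module_closed smult_l_distr subset_iff)
  also have "\<dots> = (\<Oplus>\<^bsub>M\<^esub>x\<in>?A. f x \<odot>\<^bsub>M\<^esub> b x) \<oplus>\<^bsub>M\<^esub> (\<Oplus>\<^bsub>M\<^esub>x\<in>?A. g x \<odot>\<^bsub>M\<^esub> b x)"
    using sf sg f g b by (intro M.finsum_addf) (auto simp: free_module_closed subset_iff)
  also have "(\<Oplus>\<^bsub>M\<^esub>x\<in>?A. f x \<odot>\<^bsub>M\<^esub> b x) = linear_extension R M b f"
    using sf sg f by (intro linear_extension_superset[symmetric]) auto
  also have "(\<Oplus>\<^bsub>M\<^esub>x\<in>?A. g x \<odot>\<^bsub>M\<^esub> b x) = linear_extension R M b g"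
    using sf sg g by (intro linear_extension_superset[symmetric]) auto
  finally show "linear_extension R M b (f \<oplus>\<^bsub>free_module R X\<^esub> g)
      = linear_extension R M b f \<oplus>\<^bsub>M\<^esub> linear_extension R M b g"
    by simp
qed

end

end

section \<open>Tensor products\<close>

locale module_pair = V: module k V + W: module k W
  for k (structure) and V and W
begin

abbreviation F where "F \<equiv> free_pairs k V W"
abbreviation N where "N \<equiv> tensor_kernel k V W"
abbreviation T where "T \<equiv> tensor k V W"
abbreviation g where "g v w \<equiv> free_gen k (v, w)"

sublocale F: module k F
  unfolding free_pairs_def by (rule V.module_free_module)

lemma g_closed: "v \<in> carrier V \<Longrightarrow> w \<in> carrier W \<Longrightarrow> g v w \<in> carrier F"
  unfolding free_pairs_def by (intro V.free_gen_closed) simp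

lemma bilinearity_relationsI:
  "v \<in> carrier V \<Longrightarrow> v' \<in> carrier V \<Longrightarrow> w \<in> carrier W \<Longrightarrow>
    g (v \<oplus>\<^bsub>V\<^esub> v') w \<ominus>\<^bsub>F\<^esub> (g v w \<oplus>\<^bsub>F\<^esub> g v' w) \<in> bilinearity_relations k V W"
  "v \<in> carrier V \<Longrightarrow> w \<in> carrier W \<Longrightarrow> w' \<in> carrier W \<Longrightarrow>
    g v (w \<oplus>\<^bsub>W\<^esub> w') \<ominus>\<^bsub>F\<^esub> (g v w \<oplus>\<^bsub>F\<^esub> g v w') \<in> bilinearity_relations k V W"
  "c \<in> carrier k \<Longrightarrow> v \<in> carrier V \<Longrightarrow> w \<in> carrier W \<Longrightarrow>
    g (c \<odot>\<^bsub>V\<^esub> v) w \<ominus>\<^bsub>F\<^esub> c \<odot>\<^bsub>F\<^esub> g v w \<in> bilinearity_relations k V W"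
  "c \<in> carrier k \<Longrightarrow> v \<in> carrier V \<Longrightarrow> w \<in> carrier W \<Longrightarrow>
    g v (c \<odot>\<^bsub>W\<^esub> w) \<ominus>\<^bsub>F\<^esub> c \<odot>\<^bsub>F\<^esub> g v w \<in> bilinearity_relations k V W"
  unfolding bilinearity_relations_def Let_def Un_iff mem_Collect_eq
  by (rule disjI1, rule disjI1, rule disjI1, intro exI conjI, rule refl, assumption+)
    (rule disjI1, rule disjI1, rule disjI2, intro exI conjI, rule refl, assumption+,
     rule disjI1, rule disjI2, intro exI conjI, rule refl, assumption+,
     rule disjI2, intro exI conjI, rule refl, assumption+)

text \<open>Applied with \<open>M\<close> the whole free module, and with \<open>M\<close> the
  kernel of the linear extension of a bilinear map.\<close>

lemma bilinearity_relations_subsetI: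
  assumes "\<And>v v' w. v \<in> carrier V \<Longrightarrow> v' \<in> carrier V \<Longrightarrow> w \<in> carrier W \<Longrightarrow>
      g (v \<oplus>\<^bsub>V\<^esub> v') w \<ominus>\<^bsub>F\<^esub> (g v w \<oplus>\<^bsub>F\<^esub> g v' w) \<in> M"
    "\<And>v w w'. v \<in> carrier V \<Longrightarrow> w \<in> carrier W \<Longrightarrow> w' \<in> carrier W \<Longrightarrow>
      g v (w \<oplus>\<^bsub>W\<^esub> w') \<ominus>\<^bsub>F\<^esub> (g v w \<oplus>\<^bsub>F\<^esub> g v w') \<in> M"
    "\<And>c v w. c \<in> carrier k \<Longrightarrow> v \<in> carrier V \<Longrightarrow> w \<in> carrier W \<Longrightarrow>
      g (c \<odot>\<^bsub>V\<^esub> v) w \<ominus>\<^bsub>F\<^esub> c \<odot>\<^bsub>F\<^esub> g v w \<in> M"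
    "\<And>c v w. c \<in> carrier k \<Longrightarrow> v \<in> carrier V \<Longrightarrow> w \<in> carrier W \<Longrightarrow>
      g v (c \<odot>\<^bsub>W\<^esub> w) \<ominus>\<^bsub>F\<^esub> c \<odot>\<^bsub>F\<^esub> g v w \<in> M"
  shows "bilinearity_relations k V W \<subseteq> M"
  unfolding bilinearity_relations_def Let_def
  by (intro Un_least subsetI; elim CollectE exE conjE; hypsubst; rule assms; assumption)

lemma bilinearity_relations_subset: "bilinearity_relations k V W \<subseteq> carrier F"
  by (rule bilinearity_relations_subsetI)
    (intro F.M.minus_closed F.M.a_closed F.smult_closed g_closed
      V.M.a_closed W.M.a_closed V.smult_closed W.smult_closed; assumption)+

lemma tensor_kernel_relations: "bilinearity_relations k V W \<subseteq> N"
  unfolding tensor_kernel_def by auto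

lemma tensor_kernel_least:
  assumes "submodule M k F" "bilinearity_relations k V W \<subseteq> M"
  shows "N \<subseteq> M"
  using assms unfolding tensor_kernel_def by auto

lemma submodule_tensor_kernel: "submodule N k F"
proof (rule F.submoduleI)
  show "N \<subseteq> carrier F"
    by (rule tensor_kernel_least[OF F.carrier_is_submodule bilinearity_relations_subset])
  show "\<zero>\<^bsub>F\<^esub> \<in> N"
    unfolding tensor_kernel_def
    using subgroup.one_closed[OF submodule.axioms(1)] by fastforce
qed (auto simp: tensor_kernel_def dest: F.submoduleE)

sublocale N: abelian_subgroup N F
  using submodule.axioms(1)[OF submodule_tensor_kernel] F.abelian_group_axioms
  by (intro abelian_subgroupI3 additive_subgroupI)

abbreviation coset where "coset f \<equiv> N +>\<^bsub>F\<^esub> f"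

lemma carrier_tensor: "carrier T = coset ` carrier F"
  by (auto simp: tensor_def Let_def A_RCOSETS_def')

lemma zero_tensor: "\<zero>\<^bsub>T\<^esub> = coset \<zero>\<^bsub>F\<^esub>"
  by (simp add: tensor_def Let_def N.a_rcos_const del: free_module_simps)

lemma coset_add:
  "f \<in> carrier F \<Longrightarrow> h \<in> carrier F \<Longrightarrow> coset f \<oplus>\<^bsub>T\<^esub> coset h = coset (f \<oplus>\<^bsub>F\<^esub> h)"
  by (simp add: tensor_def Let_def N.a_rcos_sum)

lemma coset_eqI:
  assumes "f \<ominus>\<^bsub>F\<^esub> h \<in> N" "f \<in> carrier F" "h \<in> carrier F"
  shows "coset f = coset h"
proof -
  have "f \<in> coset h"
    using assms by (intro N.a_rcos_module_rev) (simp_all only: F.M.minus_eq)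
  then show ?thesis using N.a_repr_independence'[of f h] assms(3) by metis
qed

text \<open>The scalar action on a coset is a union over all its representatives. Since the kernel
  is closed under scalars, every representative contributes the same coset, and the union collapses
  to it.\<close>

lemma coset_smult:
  assumes c: "c \<in> carrier k" and f: "f \<in> carrier F"
  shows "c \<odot>\<^bsub>T\<^esub> coset f = coset (c \<odot>\<^bsub>F\<^esub> f)"
proof -
  have "coset (c \<odot>\<^bsub>F\<^esub> h) = coset (c \<odot>\<^bsub>F\<^esub> f)" if h: "h \<in> coset f" for h
  proof (rule coset_eqI)
    have hF: "h \<in> carrier F" by (rule N.a_elemrcos_carrier[OF f h])
    have "h \<ominus>\<^bsub>F\<^esub> f \<in> N" using N.a_rcos_module_imp[OF f h] by (simp add: F.M.minus_eq)
    then have "c \<odot>\<^bsub>F\<^esub> (h \<ominus>\<^bsub>F\<^esub> f) \<in> N"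
      using submodule.smult_closed[OF submodule_tensor_kernel c] by blast
    then show "c \<odot>\<^bsub>F\<^esub> h \<ominus>\<^bsub>F\<^esub> c \<odot>\<^bsub>F\<^esub> f \<in> N"
      using c f hF by (simp only: F.M.minus_eq F.smult_r_distr F.smult_r_minus F.M.a_inv_closed)
    show "c \<odot>\<^bsub>F\<^esub> h \<in> carrier F" "c \<odot>\<^bsub>F\<^esub> f \<in> carrier F"
      using c f hF by blast+
  qed
  then have "(\<Union>h\<in>coset f. coset (c \<odot>\<^bsub>F\<^esub> h)) = (\<Union>h\<in>coset f. coset (c \<odot>\<^bsub>F\<^esub> f))"
    by (intro SUP_cong refl)
  also have "\<dots> = coset (c \<odot>\<^bsub>F\<^esub> f)" using N.a_rcos_self[OF f] by blast
  finally show ?thesis by (simp add: tensor_def Let_def)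
qed

lemma module_tensor: "module k T"
proof (rule moduleI)
  show "abelian_group T"
  proof (rule abelian_groupI)
    fix t assume "t \<in> carrier T"
    then obtain f where f: "f \<in> carrier F" "t = coset f" by (auto simp: carrier_tensor)
    then have "coset (\<ominus>\<^bsub>F\<^esub> f) \<oplus>\<^bsub>T\<^esub> t = \<zero>\<^bsub>T\<^esub>"
      by (simp only: coset_add zero_tensor F.M.a_inv_closed F.M.l_neg)
    with f show "\<exists>s\<in>carrier T. s \<oplus>\<^bsub>T\<^esub> t = \<zero>\<^bsub>T\<^esub>"
      by (auto simp: carrier_tensor)
  qed (auto simp: carrier_tensor zero_tensor coset_add F.M.a_ac)
qed (auto simp: carrier_tensor coset_add coset_smult V.is_cring
    F.smult_l_distr F.smult_r_distr F.smult_assoc1)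

lemma pure_tensor_eq: "pure_tensor k V W v w = coset (g v w)"
  by (simp add: pure_tensor_def)

lemma pure_tensor_closed:
  "v \<in> carrier V \<Longrightarrow> w \<in> carrier W \<Longrightarrow> pure_tensor k V W v w \<in> carrier T"
  by (auto simp: pure_tensor_eq carrier_tensor g_closed)

lemma bilinear_map_pure_tensor: "bilinear_map k V W T (pure_tensor k V W)"
proof -
  have rel: "coset a = coset b"
    if "a \<ominus>\<^bsub>F\<^esub> b \<in> bilinearity_relations k V W" "a \<in> carrier F" "b \<in> carrier F" for a b
    using that tensor_kernel_relations coset_eqI[of a b] by blast
  show ?thesis
  proof (intro bilinear_mapI linear_mapI)
    fix v v' w assume vw: "v \<in> carrier V" "v' \<in> carrier V" "w \<in> carrier W"
    show "pure_tensor k V W (v \<oplus>\<^bsub>V\<^esub> v') w = pure_tensor k V W v w \<oplus>\<^bsub>T\<^esub> pure_tensor k V W v' w"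
      using vw rel[OF bilinearity_relationsI(1)[OF vw]]
      by (simp add: pure_tensor_eq coset_add g_closed)
  next
    fix v w w' assume vw: "v \<in> carrier V" "w \<in> carrier W" "w' \<in> carrier W"
    show "pure_tensor k V W v (w \<oplus>\<^bsub>W\<^esub> w') = pure_tensor k V W v w \<oplus>\<^bsub>T\<^esub> pure_tensor k V W v w'"
      using vw rel[OF bilinearity_relationsI(2)[OF vw]]
      by (simp add: pure_tensor_eq coset_add g_closed)
  next
    fix c v w assume vw: "c \<in> carrier k" "v \<in> carrier V" "w \<in> carrier W"
    show "pure_tensor k V W (c \<odot>\<^bsub>V\<^esub> v) w = c \<odot>\<^bsub>T\<^esub> pure_tensor k V W v w"
      using vw rel[OF bilinearity_relationsI(3)[OF vw]]
      by (simp add: pure_tensor_eq coset_smult g_closed)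
  next
    fix c v w assume vw: "v \<in> carrier V" "c \<in> carrier k" "w \<in> carrier W"
    show "pure_tensor k V W v (c \<odot>\<^bsub>W\<^esub> w) = c \<odot>\<^bsub>T\<^esub> pure_tensor k V W v w"
      using vw rel[OF bilinearity_relationsI(4)[OF vw(2,1,3)]]
      by (simp add: pure_tensor_eq coset_smult g_closed)
  qed (auto simp: pure_tensor_closed)
qed

lemmas linear_map_pure_tensor_left = bilinear_map_left[OF bilinear_map_pure_tensor]
  and linear_map_pure_tensor_right = bilinear_map_right[OF bilinear_map_pure_tensor]

text \<open>No case for scalar multiples is required: a coefficient is absorbed into the left factor
  of a pure tensor. The zero tensor is likewise \<open>0 (0 \<otimes> 0)\<close>, hence
  pure.\<close>

lemma tensor_induct [consumes 1, case_names pure add]: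
  assumes "t \<in> carrier T"
    and pure: "\<And>v w. v \<in> carrier V \<Longrightarrow> w \<in> carrier W \<Longrightarrow> P (pure_tensor k V W v w)"
    and add: "\<And>s t. s \<in> carrier T \<Longrightarrow> t \<in> carrier T \<Longrightarrow> P s \<Longrightarrow> P t \<Longrightarrow> P (s \<oplus>\<^bsub>T\<^esub> t)"
  shows "P t"
proof -
  have smult: "P (coset (c \<odot>\<^bsub>F\<^esub> g v w))"
    if "c \<in> carrier k" "v \<in> carrier V" "w \<in> carrier W" for c v w
    using that pure[of "c \<odot>\<^bsub>V\<^esub> v" w] linear_map_smult[OF linear_map_pure_tensor_left, of w c v]
    by (simp add: pure_tensor_eq coset_smult g_closed)
  obtain f where f: "f \<in> carrier F" "t = coset f" using assms(1) by (auto simp: carrier_tensor)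
  then have "f \<in> carrier (free_module k (carrier V \<times> carrier W))" by (simp add: free_pairs_def)
  then have "P (coset f)"
  proof (induction rule: V.free_module_induct)
    case zero
    have "P (coset (\<zero>\<^bsub>k\<^esub> \<odot>\<^bsub>F\<^esub> g \<zero>\<^bsub>V\<^esub> \<zero>\<^bsub>W\<^esub>))" by (rule smult) auto
    also have "\<zero>\<^bsub>k\<^esub> \<odot>\<^bsub>F\<^esub> g \<zero>\<^bsub>V\<^esub> \<zero>\<^bsub>W\<^esub> = (\<lambda>x. \<zero>\<^bsub>k\<^esub>)"
      by (simp add: free_pairs_def free_gen_def fun_eq_iff)
    finally show ?case .
  next
    case (gen c x)
    then show ?case using smult[of c "fst x" "snd x"] by (auto simp: free_pairs_def)
  next
    case (add f h)
    then show ?case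
      using assms(3)[of "coset f" "coset h"] coset_add[of f h]
      by (auto simp: carrier_tensor free_pairs_def)
  qed
  with f show ?thesis by simp
qed

end

section \<open>The universal property of the tensor product\<close>

locale tensor_bilinear = module_pair k V W + U: module k U
  for k (structure) and V and W and U +
  fixes \<beta>
  assumes bilinear: "bilinear_map k V W U \<beta>"
begin

abbreviation ext where "ext \<equiv> linear_extension k U (\<lambda>p. \<beta> (fst p) (snd p))"

lemmas left_linear = bilinear_map_left[OF bilinear]
  and right_linear = bilinear_map_right[OF bilinear]

lemma bilinear_closed: "v \<in> carrier V \<Longrightarrow> w \<in> carrier W \<Longrightarrow> \<beta> v w \<in> carrier U"
  by (rule linear_map_closed[OF right_linear])

lemma linear_map_ext: "linear_map k F U ext"
  unfolding free_pairs_def by (rule U.linear_map_linear_extension) (auto simp: bilinear_closed)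

lemma ext_gen: "v \<in> carrier V \<Longrightarrow> w \<in> carrier W \<Longrightarrow> ext (g v w) = \<beta> v w"
  by (subst U.linear_extension_gen[where X = "carrier V \<times> carrier W"]) (auto simp: bilinear_closed)

lemma ext_minus:
  assumes "a \<in> carrier F" "b \<in> carrier F"
  shows "ext (a \<ominus>\<^bsub>F\<^esub> b) = ext a \<ominus>\<^bsub>U\<^esub> ext b"
  using assms
  by (simp only: F.M.minus_eq U.M.minus_eq linear_map_add[OF linear_map_ext] F.M.a_inv_closed
      linear_map_a_inv[OF F.module_axioms U.module_axioms linear_map_ext])

text \<open>The kernel of \<open>ext\<close> is a submodule, and bilinearity of
  \<open>\<beta>\<close> puts all the defining relations into it. The tensor kernel is the least
  such submodule.\<close>

lemma ext_kernel:
  assumes "f \<in> N"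
  shows "ext f = \<zero>\<^bsub>U\<^esub>"
proof -
  let ?M = "{f \<in> carrier F. ext f = \<zero>\<^bsub>U\<^esub>}"
  have rel: "a \<ominus>\<^bsub>F\<^esub> b \<in> ?M" if "a \<in> carrier F" "b \<in> carrier F" "ext a = ext b" for a b
    using that linear_map_closed[OF linear_map_ext] by (simp add: ext_minus U.M.minus_eq U.M.r_neg)
  have "N \<subseteq> ?M"
  proof (rule tensor_kernel_least)
    show "submodule ?M k F"
      by (rule submodule_kernel[OF F.module_axioms U.module_axioms linear_map_ext])
    show "bilinearity_relations k V W \<subseteq> ?M"
      by (rule bilinearity_relations_subsetI; rule rel)
        (simp_all add: g_closed linear_map_add[OF linear_map_ext]
          linear_map_smult[OF linear_map_ext] ext_gen
          linear_map_add[OF left_linear] linear_map_add[OF right_linear]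
          linear_map_smult[OF left_linear] linear_map_smult[OF right_linear])
  qed
  with assms show ?thesis by auto
qed

text \<open>This gives \<open>the_elem\<close> its meaning: representatives differ by elements that
  \<open>ext\<close> kills, so the image of the nonempty coset is a singleton.\<close>

lemma tensor_lift_coset:
  assumes f: "f \<in> carrier F"
  shows "tensor_lift k U \<beta> (coset f) = ext f"
proof -
  have "ext h = ext f" if h: "h \<in> coset f" for h
  proof -
    have hF: "h \<in> carrier F" by (rule N.a_elemrcos_carrier[OF f h])
    have "ext (h \<ominus>\<^bsub>F\<^esub> f) = \<zero>\<^bsub>U\<^esub>"
      using N.a_rcos_module_imp[OF f h] by (intro ext_kernel) (simp add: F.M.minus_eq)
    then have "ext h \<oplus>\<^bsub>U\<^esub> \<ominus>\<^bsub>U\<^esub> ext f = \<zero>\<^bsub>U\<^esub>" using f hF by (simp only: ext_minus U.M.minus_eq)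
    then have "\<ominus>\<^bsub>U\<^esub> (\<ominus>\<^bsub>U\<^esub> ext f) = ext h"
      using f hF linear_map_closed[OF linear_map_ext] by (intro U.M.minus_equality) auto
    then show ?thesis using f linear_map_closed[OF linear_map_ext] by simp
  qed
  then have "ext ` coset f = (\<lambda>_. ext f) ` coset f" by (rule image_cong[OF refl])
  also have "\<dots> = {ext f}" using N.a_rcos_self[OF f] by blast
  finally show ?thesis by (simp add: tensor_lift_def linear_extension_def[abs_def])
qed

lemma tensor_lift_pure [simp]:
  "v \<in> carrier V \<Longrightarrow> w \<in> carrier W \<Longrightarrow> tensor_lift k U \<beta> (pure_tensor k V W v w) = \<beta> v w"
  by (simp add: pure_tensor_eq tensor_lift_coset g_closed ext_gen)

lemma linear_map_tensor_lift: "linear_map k T U (tensor_lift k U \<beta>)"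
  by (rule linear_mapI)
    (auto simp: carrier_tensor coset_add coset_smult tensor_lift_coset
      linear_map_closed[OF linear_map_ext] linear_map_add[OF linear_map_ext]
      linear_map_smult[OF linear_map_ext])

end

section \<open>Equality, composition and parameters of induced maps\<close>

lemma bilinear_map_cong:
  assumes "\<And>v w. v \<in> carrier V \<Longrightarrow> w \<in> carrier W \<Longrightarrow> \<beta> v w = \<gamma> v w"
    and "module k V" "module k W"
  shows "bilinear_map k V W U \<beta> \<longleftrightarrow> bilinear_map k V W U \<gamma>"
  unfolding bilinear_map_def using assms
  by (auto cong: linear_map_cong intro!: arg_cong2[where f = conj] ball_cong linear_map_cong)

text \<open>The form in which all later "it suffices to check pure tensors" arguments are
  made.\<close>

lemma tensor_linear_eqI:
  assumes "module k V" "module k W"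
    and "linear_map k (tensor k V W) U f" "linear_map k (tensor k V W) U h"
    and "\<And>v w. v \<in> carrier V \<Longrightarrow> w \<in> carrier W \<Longrightarrow>
      f (pure_tensor k V W v w) = h (pure_tensor k V W v w)"
    and "t \<in> carrier (tensor k V W)"
  shows "f t = h t"
proof -
  interpret module_pair k V W by (intro module_pair.intro assms)
  from assms(6) show ?thesis
  proof (induction t rule: tensor_induct)
    case (add s t)
    then show ?case using assms(3,4) by (simp add: linear_map_add)
  qed (simp add: assms(5))
qed

lemma tensor_lift_map:
  assumes "module k V" "module k W" "module k U" "module k U'"
    and "bilinear_map k V W U \<beta>" "linear_map k U U' f" "t \<in> carrier (tensor k V W)"
  shows "f (tensor_lift k U \<beta> t) = tensor_lift k U' (\<lambda>v w. f (\<beta> v w)) t"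
proof -
  interpret B: tensor_bilinear k V W U \<beta>
    by (intro tensor_bilinear.intro module_pair.intro tensor_bilinear_axioms.intro assms)
  have "bilinear_map k V W U' (\<lambda>v w. f (\<beta> v w))"
    by (intro bilinear_mapI linear_map_comp[OF _ assms(6)] B.left_linear B.right_linear)
  then interpret B': tensor_bilinear k V W U' "\<lambda>v w. f (\<beta> v w)"
    by (intro tensor_bilinear.intro module_pair.intro tensor_bilinear_axioms.intro assms)
  show ?thesis
    by (rule tensor_linear_eqI[OF assms(1,2) _ _ _ assms(7)])
      (auto intro: linear_map_comp[OF B.linear_map_tensor_lift assms(6)] B'.linear_map_tensor_lift)
qed

text \<open>Bilinearity is asked of \<open>\<beta>\<close> alone, since agreement on the carriers
  transfers it to \<open>\<gamma>\<close>.\<close>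

lemma tensor_lift_cong:
  assumes "module k V" "module k W" "module k U" "bilinear_map k V W U \<beta>"
    and "\<And>v w. v \<in> carrier V \<Longrightarrow> w \<in> carrier W \<Longrightarrow> \<beta> v w = \<gamma> v w"
    and "t \<in> carrier (tensor k V W)"
  shows "tensor_lift k U \<beta> t = tensor_lift k U \<gamma> t"
proof -
  interpret B: tensor_bilinear k V W U \<beta>
    by (intro tensor_bilinear.intro module_pair.intro tensor_bilinear_axioms.intro assms)
  have "bilinear_map k V W U \<gamma>" using bilinear_map_cong[where \<beta> = \<beta> and \<gamma> = \<gamma>, OF assms(5,1,2)] assms(4)
    by blast
  then interpret B': tensor_bilinear k V W U \<gamma>
    by (intro tensor_bilinear.intro module_pair.intro tensor_bilinear_axioms.intro assms)
  show ?thesis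
    by (rule tensor_linear_eqI[OF assms(1,2) B.linear_map_tensor_lift B'.linear_map_tensor_lift _ assms(6)])
      (simp add: assms(5))
qed

text \<open>Linearity in a parameter of the integrand, with the tensor fixed. Nested Sweedler sums
  depend on the outer legs in this way, and so does the double cross product on its right factor.
  The proof is an induction on the tensor: on pure ones the claim is the hypothesis, and sums of
  linear maps are linear.\<close>

lemma linear_map_tensor_lift_param:
  assumes "module k V" "module k W" "module k U" "module k X"
    and "\<And>x. x \<in> carrier X \<Longrightarrow> bilinear_map k V W U (\<beta> x)"
    and "\<And>v w. v \<in> carrier V \<Longrightarrow> w \<in> carrier W \<Longrightarrow> linear_map k X U (\<lambda>x. \<beta> x v w)"
    and "t \<in> carrier (tensor k V W)"
  shows "linear_map k X U (\<lambda>x. tensor_lift k U (\<beta> x) t)"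
proof -
  interpret U: module k U by fact
  interpret X: module k X by fact
  interpret module_pair k V W by (intro module_pair.intro assms)
  have B: "tensor_bilinear k V W U (\<beta> x)" if "x \<in> carrier X" for x
    using that by (intro tensor_bilinear.intro module_pair.intro tensor_bilinear_axioms.intro assms)
  note lin = tensor_bilinear.linear_map_tensor_lift[OF B]
  from assms(7) show ?thesis
  proof (induction t rule: tensor_induct)
    case (pure v w)
    then show ?case
      using linear_map_cong[where V = X and k = k and U = U and f = "\<lambda>x. tensor_lift k U (\<beta> x) (pure_tensor k V W v w)" and g = "\<lambda>x. \<beta> x v w"]
        tensor_bilinear.tensor_lift_pure[OF B] assms(4,6) by simp
  next
    case (add s t)
    note closed = linear_map_closed[OF add.IH(1)] linear_map_closed[OF add.IH(2)]
    have "linear_map k X U (\<lambda>x. tensor_lift k U (\<beta> x) s \<oplus>\<^bsub>U\<^esub> tensor_lift k U (\<beta> x) t)"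
      using closed add.IH[THEN linear_map_add] add.IH[THEN linear_map_smult]
      by (intro linear_mapI) (auto simp: U.M.a_ac U.smult_r_distr)
    then show ?case
      using linear_map_cong[where V = X and k = k and U = U and f = "\<lambda>x. tensor_lift k U (\<beta> x) (s \<oplus>\<^bsub>T\<^esub> t)"]
        linear_map_add[OF lin] add.hyps assms(4) by simp
  qed
qed

lemma module_regular_module:
  assumes "field k"
  shows "module k (regular_module k)"
proof -
  interpret field k by fact
  show ?thesis
    by (rule moduleI; (intro abelian_groupI)?)
      (auto simp: regular_module_def is_cring a_ac m_ac l_distr r_distr intro: a_inv_closed l_neg)
qed

section \<open>Sweedler calculus\<close>

text \<open>The composition with \<open>f\<close> is built into this rule and the following ones, so
  that \<open>intro\<close> strips a nested expression one outer operation at a time until it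
  reaches the bare variable.\<close>

lemma linear_map_mult_left:
  assumes "unital_algebra k A" "linear_map k X A f" "y \<in> carrier A"
  shows "linear_map k X A (\<lambda>x. f x \<otimes>\<^bsub>A\<^esub> y)"
proof -
  interpret unital_algebra k A by fact
  show ?thesis
    using assms(3) linear_map_closed[OF assms(2)] linear_map_add[OF assms(2)]
      linear_map_smult[OF assms(2)]
    by (intro linear_mapI) (auto simp: l_distr smult_mult_left)
qed

lemma linear_map_mult_right:
  assumes "unital_algebra k A" "linear_map k X A f" "y \<in> carrier A"
  shows "linear_map k X A (\<lambda>x. y \<otimes>\<^bsub>A\<^esub> f x)"
proof -
  interpret unital_algebra k A by fact
  show ?thesis
    using assms(3) linear_map_closed[OF assms(2)] linear_map_add[OF assms(2)]
      linear_map_smult[OF assms(2)]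
    by (intro linear_mapI) (auto simp: r_distr smult_mult_right)
qed

lemma linear_map_bilinear_left:
  assumes "bilinear_map k V W U \<beta>" "linear_map k X V f" "w \<in> carrier W"
  shows "linear_map k X U (\<lambda>x. \<beta> (f x) w)"
  by (rule linear_map_comp[OF assms(2) bilinear_map_left[OF assms(1,3)]])

lemma linear_map_bilinear_right:
  assumes "bilinear_map k V W U \<beta>" "linear_map k X W f" "v \<in> carrier V"
  shows "linear_map k X U (\<lambda>x. \<beta> v (f x))"
  by (rule linear_map_comp[OF assms(2) bilinear_map_right[OF assms(1,3)]])

lemma linear_map_smult_left:
  assumes "module k U" "linear_map k X (regular_module k) f" "u \<in> carrier U"
  shows "linear_map k X U (\<lambda>x. f x \<odot>\<^bsub>U\<^esub> u)"
proof -
  interpret U: module k U by fact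
  show ?thesis
    using assms(3) linear_map_closed[OF assms(2)] linear_map_add[OF assms(2)]
      linear_map_smult[OF assms(2)]
    by (intro linear_mapI) (auto simp: regular_module_def U.smult_l_distr U.smult_assoc1)
qed

lemma linear_map_smult_right:
  assumes "module k U" "linear_map k X U f" "c \<in> carrier k"
  shows "linear_map k X U (\<lambda>x. c \<odot>\<^bsub>U\<^esub> f x)"
proof -
  interpret U: module k U by fact
  show ?thesis
    using assms(3) linear_map_closed[OF assms(2)] linear_map_add[OF assms(2)]
      linear_map_smult[OF assms(2)]
    by (intro linear_mapI) (auto simp: U.smult_r_distr U.smult_assoc1[symmetric] U.R.m_comm)
qed

section \<open>Sweedler sums in a coalgebra: linearity, counit, coassociativity\<close>

context coalgebra
begin

lemma module_pair_self: "module_pair k C C"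
  by (intro module_pair.intro module_axioms)

lemma tensor_bilinear_self:
  "module k U \<Longrightarrow> bilinear_map k C C U \<beta> \<Longrightarrow> tensor_bilinear k C C U \<beta>"
  by (intro tensor_bilinear.intro tensor_bilinear_axioms.intro module_pair_self)

lemma comult_closed: "x \<in> carrier C \<Longrightarrow> comult C x \<in> carrier (tensor k C C)"
  by (rule linear_map_closed[OF comult_linear])

lemma counit_closed: "x \<in> carrier C \<Longrightarrow> counit C x \<in> carrier k"
  using linear_map_closed[OF counit_linear] by (simp add: regular_module_def)

text \<open>Here the element being split varies. In \<open>linear_map_sweedler_param\<close> it is
  fixed and the integrand varies.\<close>

lemma linear_map_sweedler:
  assumes "module k U" "bilinear_map k C C U \<beta>" "linear_map k X C f"
  shows "linear_map k X U (\<lambda>x. sweedler k C (f x) U \<beta>)"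
  unfolding sweedler_def
  using linear_map_comp[OF linear_map_comp[OF assms(3) comult_linear]
      tensor_bilinear.linear_map_tensor_lift[OF tensor_bilinear_self[OF assms(1,2)]]] .

lemma linear_map_sweedler_param:
  assumes "module k U" "module k X"
    and "\<And>p q. p \<in> carrier C \<Longrightarrow> q \<in> carrier C \<Longrightarrow> linear_map k X U (\<lambda>x. \<beta> x p q)"
    and "\<And>x. x \<in> carrier X \<Longrightarrow> bilinear_map k C C U (\<beta> x)"
    and "c \<in> carrier C"
  shows "linear_map k X U (\<lambda>x. sweedler k C c U (\<beta> x))"
  unfolding sweedler_def
  using assms by (intro linear_map_tensor_lift_param[where V = C and W = C] module_axioms comult_closed)

lemma sweedler_map:
  assumes "module k U" "module k U'" "bilinear_map k C C U \<beta>" "linear_map k U U' f" "x \<in> carrier C"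
  shows "f (sweedler k C x U \<beta>) = sweedler k C x U' (\<lambda>p q. f (\<beta> p q))"
  unfolding sweedler_def using assms by (intro tensor_lift_map[where V = C and W = C] module_axioms comult_closed)

lemma sweedler_cong:
  assumes "module k U" "bilinear_map k C C U \<beta>" "x \<in> carrier C"
    and "\<And>p q. p \<in> carrier C \<Longrightarrow> q \<in> carrier C \<Longrightarrow> \<beta> p q = \<gamma> p q"
  shows "sweedler k C x U \<beta> = sweedler k C x U \<gamma>"
  unfolding sweedler_def using assms by (intro tensor_lift_cong[where V = C and W = C] module_axioms comult_closed)

text \<open>Apply \<open>f\<close> to the counit axiom and move it inside the sum and past the
  scalar.\<close>

lemma sweedler_counit_left:
  assumes "module k U" "linear_map k C U f" "x \<in> carrier C"
  shows "sweedler k C x U (\<lambda>x1 x2. counit C x1 \<odot>\<^bsub>U\<^esub> f x2) = f x"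
proof -
  have bil: "bilinear_map k C C C (\<lambda>x1 x2. counit C x1 \<odot>\<^bsub>C\<^esub> x2)"
    by (intro bilinear_mapI linear_map_smult_left linear_map_smult_right module_axioms
        linear_map_ident counit_linear counit_closed)
  have "f x = f (sweedler k C x C (\<lambda>x1 x2. counit C x1 \<odot>\<^bsub>C\<^esub> x2))"
    using assms by (simp add: counit_left)
  also have "\<dots> = sweedler k C x U (\<lambda>x1 x2. f (counit C x1 \<odot>\<^bsub>C\<^esub> x2))"
    by (rule sweedler_map[OF module_axioms assms(1) bil assms(2,3)])
  also have "\<dots> = sweedler k C x U (\<lambda>x1 x2. counit C x1 \<odot>\<^bsub>U\<^esub> f x2)"
    by (rule sweedler_cong) (use assms bil in \<open>auto simp: linear_map_smult counit_closed
        intro!: bilinear_mapI linear_map_comp[OF _ assms(2)] dest: bilinear_map_linear\<close>)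
  finally show ?thesis by simp
qed

lemma sweedler_counit_right:
  assumes "module k U" "linear_map k C U f" "x \<in> carrier C"
  shows "sweedler k C x U (\<lambda>x1 x2. counit C x2 \<odot>\<^bsub>U\<^esub> f x1) = f x"
proof -
  have bil: "bilinear_map k C C C (\<lambda>x1 x2. counit C x2 \<odot>\<^bsub>C\<^esub> x1)"
    by (intro bilinear_mapI linear_map_smult_left linear_map_smult_right module_axioms
        linear_map_ident counit_linear counit_closed)
  have "f x = f (sweedler k C x C (\<lambda>x1 x2. counit C x2 \<odot>\<^bsub>C\<^esub> x1))"
    using assms by (simp add: counit_right)
  also have "\<dots> = sweedler k C x U (\<lambda>x1 x2. f (counit C x2 \<odot>\<^bsub>C\<^esub> x1))"
    by (rule sweedler_map[OF module_axioms assms(1) bil assms(2,3)])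
  also have "\<dots> = sweedler k C x U (\<lambda>x1 x2. counit C x2 \<odot>\<^bsub>U\<^esub> f x1)"
    by (rule sweedler_cong) (use assms bil in \<open>auto simp: linear_map_smult counit_closed
        intro!: bilinear_mapI linear_map_comp[OF _ assms(2)] dest: bilinear_map_linear\<close>)
  finally show ?thesis by simp
qed

text \<open>The axiom \<open>coassoc\<close> concerns only the universal trilinear expression, the
  triple pure tensor. Any other trilinear \<open>\<gamma>\<close> is the image of that one under a
  linear map, and linear maps pass through Sweedler sums.\<close>

lemma sweedler_coassoc:
  assumes U: "module k U"
    and l1: "\<And>b c. b \<in> carrier C \<Longrightarrow> c \<in> carrier C \<Longrightarrow> linear_map k C U (\<lambda>a. \<gamma> a b c)"
    and l2: "\<And>a c. a \<in> carrier C \<Longrightarrow> c \<in> carrier C \<Longrightarrow> linear_map k C U (\<lambda>b. \<gamma> a b c)"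
    and l3: "\<And>a b. a \<in> carrier C \<Longrightarrow> b \<in> carrier C \<Longrightarrow> linear_map k C U (\<lambda>c. \<gamma> a b c)"
    and x: "x \<in> carrier C"
  shows "sweedler k C x U (\<lambda>x1 x2. sweedler k C x1 U (\<lambda>x11 x12. \<gamma> x11 x12 x2)) =
    sweedler k C x U (\<lambda>x1 x2. sweedler k C x2 U (\<lambda>x21 x22. \<gamma> x1 x21 x22))"
proof -
  interpret CC: module_pair k C C by (rule module_pair_self)
  let ?CC = "tensor k C C"
  interpret P: module_pair k C ?CC by (intro module_pair.intro module_axioms CC.module_tensor)
  let ?T = "tensor k C ?CC"
  have \<gamma>: "tensor_bilinear k C C U (\<gamma> a)" if "a \<in> carrier C" for a
    using that by (intro tensor_bilinear_self U bilinear_mapI l2 l3)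
  \<comment> \<open>Two successive lifts turn \<open>\<gamma>\<close> into a linear map on
    \<open>C \<otimes> (C \<otimes> C)\<close>: first in the last two arguments with
    \<open>a\<close> fixed, then in \<open>a\<close> and the resulting tensor.\<close>
  let ?B = "\<lambda>a. tensor_lift k U (\<gamma> a)"
  have "bilinear_map k C ?CC U ?B"
    by (intro bilinear_mapI linear_map_tensor_lift_param[where V = C and W = C] module_axioms U l1
        tensor_bilinear.linear_map_tensor_lift[OF \<gamma>] tensor_bilinear.bilinear[OF \<gamma>])
  then interpret G: tensor_bilinear k C ?CC U ?B
    by (intro tensor_bilinear.intro tensor_bilinear_axioms.intro P.module_pair_axioms U)
  let ?G = "tensor_lift k U ?B"
  let ?p = "\<lambda>a b c. pure_tensor k C ?CC a (pure_tensor k C C b c)"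
  have p1: "linear_map k C ?T (\<lambda>a. ?p a b c)" if "b \<in> carrier C" "c \<in> carrier C" for b c
    using that by (intro P.linear_map_pure_tensor_left CC.pure_tensor_closed)
  have p2: "linear_map k C ?T (\<lambda>b. ?p a b c)" if "a \<in> carrier C" "c \<in> carrier C" for a c
    using that by (intro linear_map_bilinear_right[OF P.bilinear_map_pure_tensor]
        CC.linear_map_pure_tensor_left)
  have p3: "linear_map k C ?T (\<lambda>c. ?p a b c)" if "a \<in> carrier C" "b \<in> carrier C" for a b
    using that by (intro linear_map_bilinear_right[OF P.bilinear_map_pure_tensor]
        CC.linear_map_pure_tensor_right)
  have Gp: "?G (?p a b c) = \<gamma> a b c" if "a \<in> carrier C" "b \<in> carrier C" "c \<in> carrier C" for a b c
    using that by (simp add: CC.pure_tensor_closed tensor_bilinear.tensor_lift_pure[OF \<gamma>])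
  have T: "module k ?T" by (rule P.module_tensor)
  note G = sweedler_map[OF T U _ G.linear_map_tensor_lift]
  let ?L = "\<lambda>x1 x2. sweedler k C x1 ?T (\<lambda>x11 x12. ?p x11 x12 x2)"
  let ?R = "\<lambda>x1 x2. sweedler k C x2 ?T (\<lambda>x21 x22. ?p x1 x21 x22)"
  have bp: "bilinear_map k C C ?T (\<lambda>a b. ?p a b c)" "bilinear_map k C C ?T (\<lambda>a b. ?p c a b)"
    if "c \<in> carrier C" for c
    by (rule bilinear_mapI; use that in \<open>blast intro: p1 p2 p3\<close>)+
  have L: "bilinear_map k C C ?T ?L" and R: "bilinear_map k C C ?T ?R"
    by (intro bilinear_mapI linear_map_sweedler_param linear_map_sweedler linear_map_ident T
        module_axioms p1 p3 bp; assumption)+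
  have "sweedler k C x U (\<lambda>x1 x2. sweedler k C x1 U (\<lambda>x11 x12. \<gamma> x11 x12 x2)) =
    sweedler k C x U (\<lambda>x1 x2. ?G (?L x1 x2))"
  proof (rule sweedler_cong[OF U _ x, symmetric])
    show "bilinear_map k C C U (\<lambda>x1 x2. ?G (?L x1 x2))"
      by (intro bilinear_mapI linear_map_comp[OF _ G.linear_map_tensor_lift]
          bilinear_map_linear[OF L])
    fix x1 x2 assume xs: "x1 \<in> carrier C" "x2 \<in> carrier C"
    have "?G (?L x1 x2) = sweedler k C x1 U (\<lambda>x11 x12. ?G (?p x11 x12 x2))"
      using xs by (intro G bp)
    also have "\<dots> = sweedler k C x1 U (\<lambda>x11 x12. \<gamma> x11 x12 x2)"
      using xs by (intro sweedler_cong[symmetric] bilinear_mapI l1 l2 U) (simp_all add: Gp)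
    finally show "?G (?L x1 x2) = \<dots>" .
  qed
  also have "\<dots> = ?G (sweedler k C x ?T ?L)"
    by (rule G[OF L x, symmetric])
  also have "\<dots> = ?G (sweedler k C x ?T ?R)"
    by (simp only: coassoc[OF x])
  also have "\<dots> = sweedler k C x U (\<lambda>x1 x2. ?G (?R x1 x2))"
    by (rule G[OF R x])
  also have "\<dots> = sweedler k C x U (\<lambda>x1 x2. sweedler k C x2 U (\<lambda>x21 x22. \<gamma> x1 x21 x22))"
  proof (rule sweedler_cong[OF U _ x])
    show "bilinear_map k C C U (\<lambda>x1 x2. ?G (?R x1 x2))"
      by (intro bilinear_mapI linear_map_comp[OF _ G.linear_map_tensor_lift]
          bilinear_map_linear[OF R])
    fix x1 x2 assume xs: "x1 \<in> carrier C" "x2 \<in> carrier C"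
    have "?G (?R x1 x2) = sweedler k C x2 U (\<lambda>x21 x22. ?G (?p x1 x21 x22))"
      using xs by (intro G bp)
    also have "\<dots> = sweedler k C x2 U (\<lambda>x21 x22. \<gamma> x1 x21 x22)"
      using xs by (intro sweedler_cong[symmetric] bilinear_mapI l2 l3 U) (simp_all add: Gp)
    finally show "?G (?R x1 x2) = \<dots>" .
  qed
  finally show ?thesis .
qed

end

text \<open>Lift \<open>\<beta>\<close> to a linear map on \<open>D \<otimes> D\<close> and apply it
  to the comultiplication law of \<open>f\<close>.\<close>

lemma sweedler_coalgebra_hom:
  assumes "coalgebra k C" "coalgebra k D" "coalgebra_hom k C D f"
    and U: "module k U" and \<beta>: "bilinear_map k D D U \<beta>" and x: "x \<in> carrier C"
  shows "sweedler k D (f x) U \<beta> = sweedler k C x U (\<lambda>x1 x2. \<beta> (f x1) (f x2))"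
proof -
  interpret C: coalgebra k C by fact
  interpret D: coalgebra k D by fact
  interpret B: tensor_bilinear k D D U \<beta> by (rule D.tensor_bilinear_self[OF U \<beta>])
  let ?b = "\<lambda>x1 x2. pure_tensor k D D (f x1) (f x2)"
  have f: "linear_map k C D f" and comult: "comult D (f x) = sweedler k C x (tensor k D D) ?b"
    using assms(3) x by (auto simp: coalgebra_hom_def)
  have b: "bilinear_map k C C (tensor k D D) ?b"
    by (intro bilinear_mapI linear_map_bilinear_left[OF B.bilinear_map_pure_tensor]
        linear_map_bilinear_right[OF B.bilinear_map_pure_tensor] f linear_map_closed[OF f])
  have "sweedler k D (f x) U \<beta> = tensor_lift k U \<beta> (sweedler k C x (tensor k D D) ?b)"
    by (simp add: sweedler_def[of k D] comult)
  also have "\<dots> = sweedler k C x U (\<lambda>x1 x2. tensor_lift k U \<beta> (?b x1 x2))"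
    by (rule C.sweedler_map[OF B.module_tensor U b B.linear_map_tensor_lift x])
  also have "\<dots> = sweedler k C x U (\<lambda>x1 x2. \<beta> (f x1) (f x2))"
    by (rule C.sweedler_cong[OF U _ x])
      (auto intro!: bilinear_mapI linear_map_comp[OF _ B.linear_map_tensor_lift]
        simp: bilinear_map_linear[OF b] linear_map_closed[OF f])
  finally show ?thesis .
qed

section \<open>The antipode of a Hopf algebra reverses products\<close>

context hopf_algebra
begin

lemmas linear_intros = linear_map_mult_left[OF unital_algebra_axioms]
  linear_map_mult_right[OF unital_algebra_axioms]
  linear_map_comp[OF _ antipode_linear] linear_map_ident

lemma antipode_closed: "x \<in> carrier H \<Longrightarrow> antipode H x \<in> carrier H"
  by (rule linear_map_closed[OF antipode_linear])

lemma counit_mult: "x \<in> carrier H \<Longrightarrow> y \<in> carrier H \<Longrightarrow> counit H (x \<otimes>\<^bsub>H\<^esub> y) = counit H x \<otimes> counit H y"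
  by (rule ring_hom_mult[OF counit_ring_hom])

lemma counit_one: "counit H \<one>\<^bsub>H\<^esub> = \<one>"
  by (rule ring_hom_one[OF counit_ring_hom])

lemma sweedler_one:
  assumes "module k U" "bilinear_map k H H U \<beta>"
  shows "sweedler k H \<one>\<^bsub>H\<^esub> U \<beta> = \<beta> \<one>\<^bsub>H\<^esub> \<one>\<^bsub>H\<^esub>"
  by (simp add: sweedler_def comult_one
      tensor_bilinear.tensor_lift_pure[OF tensor_bilinear_self[OF assms]])

text \<open>\<open>comult_mult\<close> is the case where the integrand is the pure tensor; the
  general case is its image under the lift of \<open>\<beta>\<close>.\<close>

lemma sweedler_mult:
  assumes U: "module k U" and \<beta>: "bilinear_map k H H U \<beta>"
    and xy: "x \<in> carrier H" "y \<in> carrier H"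
  shows "sweedler k H (x \<otimes>\<^bsub>H\<^esub> y) U \<beta> =
    sweedler k H x U (\<lambda>x1 x2. sweedler k H y U (\<lambda>y1 y2. \<beta> (x1 \<otimes>\<^bsub>H\<^esub> y1) (x2 \<otimes>\<^bsub>H\<^esub> y2)))"
proof -
  interpret B: tensor_bilinear k H H U \<beta> by (rule tensor_bilinear_self[OF U \<beta>])
  let ?b = "\<lambda>x1 x2 y1 y2. pure_tensor k H H (x1 \<otimes>\<^bsub>H\<^esub> y1) (x2 \<otimes>\<^bsub>H\<^esub> y2)"
  let ?s = "\<lambda>x1 x2. sweedler k H y (tensor k H H) (?b x1 x2)"
  note lin = linear_map_bilinear_left[OF B.bilinear_map_pure_tensor]
    linear_map_bilinear_right[OF B.bilinear_map_pure_tensor] linear_intros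
  have b: "bilinear_map k H H (tensor k H H) (?b x1 x2)"
    if "x1 \<in> carrier H" "x2 \<in> carrier H" for x1 x2
    using that by (intro bilinear_mapI lin m_closed)
  have s: "bilinear_map k H H (tensor k H H) ?s"
    using xy(2) b
    by (intro bilinear_mapI linear_map_sweedler_param B.module_tensor module_axioms lin m_closed)
  have inner: "tensor_lift k U \<beta> (?s x1 x2) =
      sweedler k H y U (\<lambda>y1 y2. \<beta> (x1 \<otimes>\<^bsub>H\<^esub> y1) (x2 \<otimes>\<^bsub>H\<^esub> y2))"
    if "x1 \<in> carrier H" "x2 \<in> carrier H" for x1 x2
  proof -
    have "tensor_lift k U \<beta> (?s x1 x2) = sweedler k H y U (\<lambda>y1 y2. tensor_lift k U \<beta> (?b x1 x2 y1 y2))"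
      by (rule sweedler_map[OF B.module_tensor U b[OF that] B.linear_map_tensor_lift xy(2)])
    also have "\<dots> = sweedler k H y U (\<lambda>y1 y2. \<beta> (x1 \<otimes>\<^bsub>H\<^esub> y1) (x2 \<otimes>\<^bsub>H\<^esub> y2))"
      using that
      by (intro sweedler_cong[OF U _ xy(2)] bilinear_mapI
          linear_map_comp[OF _ B.linear_map_tensor_lift] bilinear_map_linear[OF b]) auto
    finally show ?thesis .
  qed
  have "sweedler k H (x \<otimes>\<^bsub>H\<^esub> y) U \<beta> = tensor_lift k U \<beta> (sweedler k H x (tensor k H H) ?s)"
    using xy by (simp add: comult_mult sweedler_def[of k H "_ \<otimes>\<^bsub>H\<^esub> _"])
  also have "\<dots> = sweedler k H x U (\<lambda>x1 x2. tensor_lift k U \<beta> (?s x1 x2))"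
    by (rule sweedler_map[OF B.module_tensor U s B.linear_map_tensor_lift xy(1)])
  also have "\<dots> = sweedler k H x U (\<lambda>x1 x2. sweedler k H y U (\<lambda>y1 y2. \<beta> (x1 \<otimes>\<^bsub>H\<^esub> y1) (x2 \<otimes>\<^bsub>H\<^esub> y2)))"
    by (intro sweedler_cong[OF U _ xy(1)] bilinear_mapI
        linear_map_comp[OF _ B.linear_map_tensor_lift] bilinear_map_linear[OF s] inner)
  finally show ?thesis .
qed

text \<open>The unit is grouplike with counit one, so the left antipode axiom at the unit has the
  single term \<open>S 1 \<cdot> 1\<close>.\<close>

lemma antipode_one: "antipode H \<one>\<^bsub>H\<^esub> = \<one>\<^bsub>H\<^esub>"
proof -
  have "bilinear_map k H H H (\<lambda>x1 x2. antipode H x1 \<otimes>\<^bsub>H\<^esub> x2)"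
    by (intro bilinear_mapI linear_intros antipode_closed)
  from sweedler_one[OF module_axioms this] antipode_left[of "\<one>\<^bsub>H\<^esub>"] show ?thesis
    by (simp add: counit_one antipode_closed)
qed

text \<open>Multiply the antipode axiom by \<open>t\<close> on the right. The product is bracketed
  to the right so that \<open>x2 t\<close> can be replaced as a unit before coassociativity is
  used.\<close>

lemma antipode_cancel_left:
  assumes "x \<in> carrier H" "t \<in> carrier H"
  shows "sweedler k H x H (\<lambda>x1 x2. antipode H x1 \<otimes>\<^bsub>H\<^esub> (x2 \<otimes>\<^bsub>H\<^esub> t)) = counit H x \<odot>\<^bsub>H\<^esub> t"
proof -
  have bil: "bilinear_map k H H H (\<lambda>x1 x2. antipode H x1 \<otimes>\<^bsub>H\<^esub> x2)"
    by (intro bilinear_mapI linear_intros antipode_closed)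
  have "counit H x \<odot>\<^bsub>H\<^esub> t = sweedler k H x H (\<lambda>x1 x2. antipode H x1 \<otimes>\<^bsub>H\<^esub> x2) \<otimes>\<^bsub>H\<^esub> t"
    using assms by (simp add: antipode_left smult_mult_left counit_closed)
  also have "\<dots> = sweedler k H x H (\<lambda>x1 x2. antipode H x1 \<otimes>\<^bsub>H\<^esub> x2 \<otimes>\<^bsub>H\<^esub> t)"
    using assms
    by (intro sweedler_map[where f = "\<lambda>u. u \<otimes>\<^bsub>H\<^esub> t"] module_axioms bil linear_intros)
  also have "\<dots> = sweedler k H x H (\<lambda>x1 x2. antipode H x1 \<otimes>\<^bsub>H\<^esub> (x2 \<otimes>\<^bsub>H\<^esub> t))"
    using assms
    by (intro sweedler_cong module_axioms bilinear_mapI linear_intros m_closed)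
      (auto simp: antipode_closed m_assoc)
  finally show ?thesis by simp
qed

text \<open>Multiply by \<open>S x\<^sub>1 x\<^sub>2\<close> on the left:
  \<open>y\<^sub>1 S (x y\<^sub>2) = S x\<^sub>1 x\<^sub>2 y\<^sub>1 S (x\<^sub>3 y\<^sub>2) = \<epsilon> (x\<^sub>2 y) S x\<^sub>1\<close>.\<close>

lemma sweedler_mult_antipode_mult:
  assumes x: "x \<in> carrier H" and y: "y \<in> carrier H"
  shows "sweedler k H y H (\<lambda>y1 y2. y1 \<otimes>\<^bsub>H\<^esub> antipode H (x \<otimes>\<^bsub>H\<^esub> y2)) = counit H y \<odot>\<^bsub>H\<^esub> antipode H x"
proof -
  let ?S = "antipode H" and ?e = "counit H"
  \<comment> \<open>\<open>P\<close> is the left-hand side as a function of \<open>x\<close>.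
    \<open>G\<close> is evaluated in two ways: for separate arguments it is
    \<open>b \<cdot> P c\<close>, and summed over the two legs of \<open>c\<close> it is the right
    antipode axiom for the product \<open>c y\<close>.\<close>
  define G where "G b c = sweedler k H y H (\<lambda>y1 y2. (b \<otimes>\<^bsub>H\<^esub> y1) \<otimes>\<^bsub>H\<^esub> ?S (c \<otimes>\<^bsub>H\<^esub> y2))" for b c
  define P where "P c = sweedler k H y H (\<lambda>y1 y2. y1 \<otimes>\<^bsub>H\<^esub> ?S (c \<otimes>\<^bsub>H\<^esub> y2))" for c
  note closed = m_closed antipode_closed
  note lin = linear_intros closed module_axioms
  have G_lin: "linear_map k H H (\<lambda>b. G b c)" if "c \<in> carrier H" for c
    unfolding G_def using that y by (intro linear_map_sweedler_param bilinear_mapI lin)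
  have G_lin': "linear_map k H H (\<lambda>c. G b c)" if "b \<in> carrier H" for b
    unfolding G_def using that y by (intro linear_map_sweedler_param bilinear_mapI lin)
  have P_lin: "linear_map k H H P"
    unfolding P_def using y by (intro linear_map_sweedler_param bilinear_mapI lin)
  have P_bil: "bilinear_map k H H H (\<lambda>y1 y2. y1 \<otimes>\<^bsub>H\<^esub> ?S (c \<otimes>\<^bsub>H\<^esub> y2))" if "c \<in> carrier H" for c
    using that by (intro bilinear_mapI lin)
  note G_closed = linear_map_closed[OF G_lin'] and P_closed = linear_map_closed[OF P_lin]
  have G_eq: "G b c = b \<otimes>\<^bsub>H\<^esub> P c" if "b \<in> carrier H" "c \<in> carrier H" for b c
  proof -
    have "b \<otimes>\<^bsub>H\<^esub> P c = sweedler k H y H (\<lambda>y1 y2. b \<otimes>\<^bsub>H\<^esub> (y1 \<otimes>\<^bsub>H\<^esub> ?S (c \<otimes>\<^bsub>H\<^esub> y2)))"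
      unfolding P_def
      using that y by (intro sweedler_map[where f = "\<lambda>u. b \<otimes>\<^bsub>H\<^esub> u"] P_bil lin)
    also have "\<dots> = G b c"
      unfolding G_def using that y
      by (intro sweedler_cong bilinear_mapI lin) (auto simp: m_assoc closed)
    finally show ?thesis by simp
  qed
  have G_sum: "sweedler k H c H G = (?e c \<otimes> ?e y) \<odot>\<^bsub>H\<^esub> \<one>\<^bsub>H\<^esub>" if "c \<in> carrier H" for c
  proof -
    have "sweedler k H (c \<otimes>\<^bsub>H\<^esub> y) H (\<lambda>x1 x2. x1 \<otimes>\<^bsub>H\<^esub> ?S x2) = sweedler k H c H G"
      unfolding G_def using that y by (intro sweedler_mult bilinear_mapI lin)
    then show ?thesis using that y by (simp add: antipode_right counit_mult)
  qed
  have "P x = sweedler k H x H (\<lambda>x1 x2. ?e x1 \<odot>\<^bsub>H\<^esub> P x2)"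
    by (rule sweedler_counit_left[OF module_axioms P_lin x, symmetric])
  also have "\<dots> = sweedler k H x H (\<lambda>x1 x2. sweedler k H x1 H (\<lambda>p q. ?S p \<otimes>\<^bsub>H\<^esub> G q x2))"
  proof (rule sweedler_cong[OF module_axioms _ x])
    show "bilinear_map k H H H (\<lambda>x1 x2. ?e x1 \<odot>\<^bsub>H\<^esub> P x2)"
      by (intro bilinear_mapI linear_map_smult_left linear_map_smult_right counit_linear
          counit_closed P_lin P_closed module_axioms)
    fix x1 x2 assume xs: "x1 \<in> carrier H" "x2 \<in> carrier H"
    have "sweedler k H x1 H (\<lambda>p q. ?S p \<otimes>\<^bsub>H\<^esub> G q x2) =
        sweedler k H x1 H (\<lambda>p q. ?S p \<otimes>\<^bsub>H\<^esub> (q \<otimes>\<^bsub>H\<^esub> P x2))"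
      using xs by (intro sweedler_cong bilinear_mapI lin G_lin G_lin' G_closed) (simp_all add: G_eq)
    also have "\<dots> = ?e x1 \<odot>\<^bsub>H\<^esub> P x2"
      using xs by (intro antipode_cancel_left P_closed)
    finally show "?e x1 \<odot>\<^bsub>H\<^esub> P x2 = sweedler k H x1 H (\<lambda>p q. ?S p \<otimes>\<^bsub>H\<^esub> G q x2)" by simp
  qed
  also have "\<dots> = sweedler k H x H (\<lambda>x1 x2. sweedler k H x2 H (\<lambda>p q. ?S x1 \<otimes>\<^bsub>H\<^esub> G p q))"
    using x by (intro sweedler_coassoc lin G_lin G_lin' G_closed)
  also have "\<dots> = sweedler k H x H (\<lambda>x1 x2. ?e x2 \<odot>\<^bsub>H\<^esub> (?e y \<odot>\<^bsub>H\<^esub> ?S x1))"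
  proof (rule sweedler_cong[OF module_axioms _ x, symmetric])
    show "bilinear_map k H H H (\<lambda>x1 x2. ?e x2 \<odot>\<^bsub>H\<^esub> (?e y \<odot>\<^bsub>H\<^esub> ?S x1))"
      using y by (intro bilinear_mapI linear_map_smult_left linear_map_smult_right counit_linear
          counit_closed lin smult_closed)
    fix x1 x2 assume xs: "x1 \<in> carrier H" "x2 \<in> carrier H"
    have "sweedler k H x2 H (\<lambda>p q. ?S x1 \<otimes>\<^bsub>H\<^esub> G p q) = ?S x1 \<otimes>\<^bsub>H\<^esub> sweedler k H x2 H G"
      using xs by (intro sweedler_map[symmetric, where f = "\<lambda>u. ?S x1 \<otimes>\<^bsub>H\<^esub> u"] bilinear_mapI lin G_lin G_lin')
    also have "\<dots> = ?e x2 \<odot>\<^bsub>H\<^esub> (?e y \<odot>\<^bsub>H\<^esub> ?S x1)"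
      using xs y by (simp add: G_sum smult_mult_right antipode_closed counit_closed smult_assoc1)
    finally show "?e x2 \<odot>\<^bsub>H\<^esub> (?e y \<odot>\<^bsub>H\<^esub> ?S x1) = sweedler k H x2 H (\<lambda>p q. ?S x1 \<otimes>\<^bsub>H\<^esub> G p q)"
      by simp
  qed
  also have "\<dots> = ?e y \<odot>\<^bsub>H\<^esub> ?S x"
    using x y by (intro sweedler_counit_right linear_map_smult_right antipode_linear counit_closed
        module_axioms)
  finally show ?thesis by (simp add: P_def)
qed

text \<open>\<open>S (x y) = S y\<^sub>1 y\<^sub>2 S (x y\<^sub>3)\<close>, and the previous lemma evaluates the last two factors.\<close>

lemma antipode_mult:
  assumes x: "x \<in> carrier H" and y: "y \<in> carrier H"
  shows "antipode H (x \<otimes>\<^bsub>H\<^esub> y) = antipode H y \<otimes>\<^bsub>H\<^esub> antipode H x"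
proof -
  let ?S = "antipode H" and ?e = "counit H"
  note lin = linear_intros m_closed antipode_closed module_axioms
  note smult_lin = linear_map_smult_left linear_map_smult_right counit_linear counit_closed
  have "?S (x \<otimes>\<^bsub>H\<^esub> y) = sweedler k H y H (\<lambda>y1 y2. ?e y1 \<odot>\<^bsub>H\<^esub> ?S (x \<otimes>\<^bsub>H\<^esub> y2))"
    using x y by (intro sweedler_counit_left[symmetric] lin)
  also have "\<dots> = sweedler k H y H (\<lambda>y1 y2. sweedler k H y1 H
      (\<lambda>p q. ?S p \<otimes>\<^bsub>H\<^esub> (q \<otimes>\<^bsub>H\<^esub> ?S (x \<otimes>\<^bsub>H\<^esub> y2))))"
    using x y
    by (intro sweedler_cong bilinear_mapI smult_lin lin antipode_cancel_left[symmetric])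
  also have "\<dots> = sweedler k H y H (\<lambda>y1 y2. sweedler k H y2 H
      (\<lambda>p q. ?S y1 \<otimes>\<^bsub>H\<^esub> (p \<otimes>\<^bsub>H\<^esub> ?S (x \<otimes>\<^bsub>H\<^esub> q))))"
    using x y by (intro sweedler_coassoc lin)
  also have "\<dots> = sweedler k H y H (\<lambda>y1 y2. ?e y2 \<odot>\<^bsub>H\<^esub> (?S y1 \<otimes>\<^bsub>H\<^esub> ?S x))"
  proof (rule sweedler_cong[OF module_axioms _ y, symmetric])
    show "bilinear_map k H H H (\<lambda>y1 y2. ?e y2 \<odot>\<^bsub>H\<^esub> (?S y1 \<otimes>\<^bsub>H\<^esub> ?S x))"
      using x by (intro bilinear_mapI smult_lin lin)
    fix y1 y2 assume ys: "y1 \<in> carrier H" "y2 \<in> carrier H"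
    have "sweedler k H y2 H (\<lambda>p q. ?S y1 \<otimes>\<^bsub>H\<^esub> (p \<otimes>\<^bsub>H\<^esub> ?S (x \<otimes>\<^bsub>H\<^esub> q))) =
        ?S y1 \<otimes>\<^bsub>H\<^esub> sweedler k H y2 H (\<lambda>p q. p \<otimes>\<^bsub>H\<^esub> ?S (x \<otimes>\<^bsub>H\<^esub> q))"
      using x ys
      by (intro sweedler_map[symmetric, where f = "\<lambda>u. ?S y1 \<otimes>\<^bsub>H\<^esub> u"] bilinear_mapI lin)
    also have "\<dots> = ?e y2 \<odot>\<^bsub>H\<^esub> (?S y1 \<otimes>\<^bsub>H\<^esub> ?S x)"
      using x ys
      by (simp add: sweedler_mult_antipode_mult smult_mult_right antipode_closed counit_closed)
    finally show "?e y2 \<odot>\<^bsub>H\<^esub> (?S y1 \<otimes>\<^bsub>H\<^esub> ?S x) =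
        sweedler k H y2 H (\<lambda>p q. ?S y1 \<otimes>\<^bsub>H\<^esub> (p \<otimes>\<^bsub>H\<^esub> ?S (x \<otimes>\<^bsub>H\<^esub> q)))"
      by simp
  qed
  also have "\<dots> = ?S y \<otimes>\<^bsub>H\<^esub> ?S x"
    using x y by (intro sweedler_counit_right lin)
  finally show ?thesis .
qed

end

text \<open>Pushes \<open>f\<close> under two independent sums and rewrites the integrand in the
  same move. With \<open>f\<close> the identity it is a congruence rule, and read backwards it pulls
  a linear map out of a double sum.\<close>

lemma sweedler_sweedler_map:
  assumes C: "coalgebra k C" and D: "coalgebra k D" and U: "module k U" and U': "module k U'"
    and f: "linear_map k U U' f" and x: "x \<in> carrier C" and a: "a \<in> carrier D"
    and b1: "\<And>x1 x2. x1 \<in> carrier C \<Longrightarrow> x2 \<in> carrier C \<Longrightarrow> bilinear_map k D D U (\<gamma> x1 x2)"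
    and b2: "\<And>a1 a2. a1 \<in> carrier D \<Longrightarrow> a2 \<in> carrier D \<Longrightarrow>
      bilinear_map k C C U (\<lambda>x1 x2. \<gamma> x1 x2 a1 a2)"
    and eq: "\<And>x1 x2 a1 a2. x1 \<in> carrier C \<Longrightarrow> x2 \<in> carrier C \<Longrightarrow> a1 \<in> carrier D \<Longrightarrow>
      a2 \<in> carrier D \<Longrightarrow> f (\<gamma> x1 x2 a1 a2) = \<gamma>' x1 x2 a1 a2"
  shows "f (sweedler k C x U (\<lambda>x1 x2. sweedler k D a U (\<gamma> x1 x2))) =
    sweedler k C x U' (\<lambda>x1 x2. sweedler k D a U' (\<gamma>' x1 x2))"
proof -
  interpret C: coalgebra k C by fact
  interpret D: coalgebra k D by fact
  have s: "bilinear_map k C C U (\<lambda>x1 x2. sweedler k D a U (\<gamma> x1 x2))"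
    by (intro bilinear_mapI D.linear_map_sweedler_param U C.module_axioms b1 a
        bilinear_map_left[OF b2] bilinear_map_right[OF b2])
  have fb1: "bilinear_map k D D U' (\<lambda>a1 a2. f (\<gamma> x1 x2 a1 a2))"
    if "x1 \<in> carrier C" "x2 \<in> carrier C" for x1 x2
    by (intro bilinear_mapI linear_map_comp[OF _ f] bilinear_map_linear[OF b1[OF that]])
  have "f (sweedler k C x U (\<lambda>x1 x2. sweedler k D a U (\<gamma> x1 x2))) =
      sweedler k C x U' (\<lambda>x1 x2. f (sweedler k D a U (\<gamma> x1 x2)))"
    by (rule C.sweedler_map[OF U U' s f x])
  also have "\<dots> = sweedler k C x U' (\<lambda>x1 x2. sweedler k D a U' (\<gamma>' x1 x2))"
  proof (rule C.sweedler_cong[OF U' _ x])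
    show "bilinear_map k C C U' (\<lambda>x1 x2. f (sweedler k D a U (\<gamma> x1 x2)))"
      by (intro bilinear_mapI linear_map_comp[OF _ f] bilinear_map_linear[OF s])
    fix x1 x2 assume xs: "x1 \<in> carrier C" "x2 \<in> carrier C"
    have "f (sweedler k D a U (\<gamma> x1 x2)) = sweedler k D a U' (\<lambda>a1 a2. f (\<gamma> x1 x2 a1 a2))"
      by (rule D.sweedler_map[OF U U' b1[OF xs] f a])
    also have "\<dots> = sweedler k D a U' (\<gamma>' x1 x2)"
      by (rule D.sweedler_cong[OF U' fb1[OF xs] a]) (rule eq[OF xs])
    finally show "f (sweedler k D a U (\<gamma> x1 x2)) = sweedler k D a U' (\<gamma>' x1 x2)" .
  qed
  finally show ?thesis .
qed

section \<open>The double cross product\<close>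

text \<open>The antipode of the double cross product is lifted into the tensor coalgebra, a larger
  record than the plain tensor module. A lift reads only the additive and scalar fields, which the
  two share.\<close>

lemma tensor_lift_carrier_cong:
  assumes "carrier U = carrier U'" "add U = add U'" "zero U = zero U'" "smult U = smult U'"
  shows "tensor_lift k U \<beta> = tensor_lift k U' \<beta>"
  by (simp add: tensor_lift_def finsum_def finprod_def assms fun_eq_iff)

section \<open>The structure maps of the double cross product on pure tensors\<close>

context matched_pair
begin

abbreviation T where "T \<equiv> tensor k K H"
abbreviation D where "D \<equiv> double_cross_product k H K lact ract"
abbreviation p where "p \<equiv> pure_tensor k K H"

sublocale KH: module_pair k K H
  by (intro module_pair.intro K.module_axioms H.module_axioms)

sublocale TT: module_pair k T T
  by (intro module_pair.intro KH.module_tensor)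

lemma bilinear_lact: "bilinear_map k H K K lact"
  using lact_module_coalgebra by (simp add: left_module_coalgebra_def)

lemma bilinear_ract: "bilinear_map k H K H ract"
  using ract_module_coalgebra by (simp add: right_module_coalgebra_def)

lemma lact_unit: "a \<in> carrier K \<Longrightarrow> \<one>\<^bsub>H\<^esub> \<rightharpoonup> a = a"
  using lact_module_coalgebra by (simp add: left_module_coalgebra_def)

lemma lact_closed: "x \<in> carrier H \<Longrightarrow> a \<in> carrier K \<Longrightarrow> x \<rightharpoonup> a \<in> carrier K"
  by (rule linear_map_closed[OF bilinear_map_right[OF bilinear_lact]])

lemma ract_closed: "x \<in> carrier H \<Longrightarrow> a \<in> carrier K \<Longrightarrow> x \<leftharpoonup> a \<in> carrier H"
  by (rule linear_map_closed[OF bilinear_map_right[OF bilinear_ract]])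

lemmas modules = H.module_axioms K.module_axioms KH.module_tensor TT.module_tensor

lemmas closed = H.m_closed K.m_closed H.antipode_closed K.antipode_closed H.one_closed K.one_closed
  lact_closed ract_closed KH.pure_tensor_closed TT.pure_tensor_closed

text \<open>A syntax-directed rule set: the integrands below are built from products, antipodes, the
  two actions, pure tensors and Sweedler sums, so \<open>intro lin\<close> can decompose them when
  proving bilinearity.\<close>

lemmas lin = H.linear_intros K.linear_intros
  linear_map_bilinear_left[OF bilinear_lact] linear_map_bilinear_right[OF bilinear_lact]
  linear_map_bilinear_left[OF bilinear_ract] linear_map_bilinear_right[OF bilinear_ract]
  linear_map_bilinear_left[OF KH.bilinear_map_pure_tensor]
  linear_map_bilinear_right[OF KH.bilinear_map_pure_tensor]
  linear_map_bilinear_left[OF TT.bilinear_map_pure_tensor]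
  linear_map_bilinear_right[OF TT.bilinear_map_pure_tensor]
  H.linear_map_sweedler_param K.linear_map_sweedler_param
  H.linear_map_sweedler K.linear_map_sweedler
  bilinear_mapI closed modules

text \<open>The product of \<open>a \<otimes> x\<close> and \<open>b \<otimes> y\<close>, kept as a
  function of four vectors because the multiplication lifts it twice: over the right factor inside,
  over the left factor outside.\<close>

definition pure_mult where
  "pure_mult a x b y = sweedler k H x T (\<lambda>x1 x2. sweedler k K b T (\<lambda>b1 b2.
     p (a \<otimes>\<^bsub>K\<^esub> (x1 \<rightharpoonup> b1)) ((x2 \<leftharpoonup> b2) \<otimes>\<^bsub>H\<^esub> y)))"

lemma bilinear_pure_mult:
  "a \<in> carrier K \<Longrightarrow> x \<in> carrier H \<Longrightarrow> bilinear_map k K H T (pure_mult a x)"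
  unfolding pure_mult_def by (intro lin)

lemma bilinear_pure_mult':
  "b \<in> carrier K \<Longrightarrow> y \<in> carrier H \<Longrightarrow> bilinear_map k K H T (\<lambda>a x. pure_mult a x b y)"
  unfolding pure_mult_def by (intro lin)

lemma mult_D: "s \<otimes>\<^bsub>D\<^esub> t = tensor_lift k T (\<lambda>a x. tensor_lift k T (pure_mult a x) t) s"
  by (simp add: double_cross_product_def coalgebra.defs tensor_coalgebra_def module.defs Let_def
      double_cross_mult_def pure_mult_def[abs_def])

lemma D_simps [simp]: "carrier D = carrier T" "add D = add T" "zero D = zero T" "smult D = smult T"
    "\<one>\<^bsub>D\<^esub> = p \<one>\<^bsub>K\<^esub> \<one>\<^bsub>H\<^esub>"
  by (simp_all add: double_cross_product_def coalgebra.defs tensor_coalgebra_def module.defs Let_def)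

lemma linear_map_D: "linear_map k D U f \<longleftrightarrow> linear_map k T U f"
  by (simp add: linear_map_def)

lemma tensor_bilinear_pure_mult:
  "a \<in> carrier K \<Longrightarrow> x \<in> carrier H \<Longrightarrow> tensor_bilinear k K H T (pure_mult a x)"
  by (intro tensor_bilinear.intro tensor_bilinear_axioms.intro KH.module_pair_axioms
      KH.module_tensor bilinear_pure_mult)

lemma bilinear_mult_D_pure:
  assumes "t \<in> carrier T"
  shows "bilinear_map k K H T (\<lambda>a x. tensor_lift k T (pure_mult a x) t)"
  using assms
  by (intro bilinear_mapI linear_map_tensor_lift_param[where V = K and W = H] modules
      bilinear_pure_mult bilinear_map_left[OF bilinear_pure_mult']
      bilinear_map_right[OF bilinear_pure_mult'])

lemma tensor_bilinear_mult_D: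
  "t \<in> carrier T \<Longrightarrow> tensor_bilinear k K H T (\<lambda>a x. tensor_lift k T (pure_mult a x) t)"
  by (intro tensor_bilinear.intro tensor_bilinear_axioms.intro KH.module_pair_axioms
      KH.module_tensor bilinear_mult_D_pure)

text \<open>Linearity in the left factor is that of the outer lift. The right factor is a parameter
  of the outer integrand.\<close>

lemma bilinear_mult_D: "bilinear_map k T T T (mult D)"
  unfolding mult_D[abs_def]
  by (intro bilinear_mapI linear_map_tensor_lift_param[where V = K and W = H] modules
      bilinear_mult_D_pure tensor_bilinear.linear_map_tensor_lift[OF tensor_bilinear_mult_D]
      tensor_bilinear.linear_map_tensor_lift[OF tensor_bilinear_pure_mult])

lemma mult_D_pure:
  assumes "a \<in> carrier K" "x \<in> carrier H" "b \<in> carrier K" "y \<in> carrier H"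
  shows "p a x \<otimes>\<^bsub>D\<^esub> p b y = pure_mult a x b y"
  using assms unfolding mult_D
  by (simp add: tensor_bilinear.tensor_lift_pure[OF tensor_bilinear_mult_D]
      tensor_bilinear.tensor_lift_pure[OF tensor_bilinear_pure_mult] closed)

text \<open>The unit of \<open>H\<close> splits as \<open>1 \<otimes> 1\<close>; its left copy fixes
  \<open>b1\<close>, its right copy turns into the scalar \<open>\<epsilon> b2\<close>, and the
  counit recombines \<open>b\<close>. This yields both the factorization of pure tensors and the
  multiplicativity of \<open>a \<mapsto> a \<otimes> 1\<close>.\<close>

lemma mult_D_pure_one_left:
  assumes a: "a \<in> carrier K" and b: "b \<in> carrier K" and y: "y \<in> carrier H"
  shows "p a \<one>\<^bsub>H\<^esub> \<otimes>\<^bsub>D\<^esub> p b y = p (a \<otimes>\<^bsub>K\<^esub> b) y"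
proof -
  have "p a \<one>\<^bsub>H\<^esub> \<otimes>\<^bsub>D\<^esub> p b y = pure_mult a \<one>\<^bsub>H\<^esub> b y"
    by (rule mult_D_pure) (use assms in auto)
  also have "\<dots> = sweedler k K b T (\<lambda>b1 b2. p (a \<otimes>\<^bsub>K\<^esub> (\<one>\<^bsub>H\<^esub> \<rightharpoonup> b1)) ((\<one>\<^bsub>H\<^esub> \<leftharpoonup> b2) \<otimes>\<^bsub>H\<^esub> y))"
    unfolding pure_mult_def using assms by (intro H.sweedler_one lin)
  also have "\<dots> = sweedler k K b T (\<lambda>b1 b2. counit K b2 \<odot>\<^bsub>T\<^esub> p (a \<otimes>\<^bsub>K\<^esub> b1) y)"
    using assms
    by (intro K.sweedler_cong lin)
      (simp_all add: lact_unit ract_one H.smult_mult_left K.counit_closed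
        linear_map_smult[OF KH.linear_map_pure_tensor_right])
  also have "\<dots> = p (a \<otimes>\<^bsub>K\<^esub> b) y"
    using assms by (intro K.sweedler_counit_right[where f = "\<lambda>b. p (a \<otimes>\<^bsub>K\<^esub> b) y"] lin)
  finally show ?thesis .
qed

lemma counit_D: "counit D = tensor_lift k (regular_module k) (\<lambda>a x. counit K a \<otimes>\<^bsub>k\<^esub> counit H x)"
  by (simp add: double_cross_product_def coalgebra.defs tensor_coalgebra_def module.defs Let_def)

lemma counit_D_bilinear:
  "tensor_bilinear k K H (regular_module k) (\<lambda>a x. counit K a \<otimes>\<^bsub>k\<^esub> counit H x)"
proof -
  \<comment> \<open>In the regular module, scaling is multiplication of scalars, so the linearity
    rules for \<open>smult\<close> also cover products of counits.\<close>
  have "smult (regular_module k) = mult k" by (simp add: regular_module_def)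
  note smult_lin = linear_map_smult_left[where U = "regular_module k", unfolded this]
    linear_map_smult_right[where U = "regular_module k", unfolded this]
  have "module k (regular_module k)" by (rule module_regular_module[OF H.field_axioms])
  moreover have "\<And>x. x \<in> carrier H \<Longrightarrow> counit H x \<in> carrier (regular_module k)"
    by (simp add: regular_module_def H.counit_closed)
  ultimately show ?thesis
    by (intro tensor_bilinear.intro tensor_bilinear_axioms.intro KH.module_pair_axioms
        bilinear_mapI smult_lin K.counit_linear H.counit_linear K.counit_closed)
qed

lemmas linear_map_counit_D =
    tensor_bilinear.linear_map_tensor_lift[OF counit_D_bilinear, folded counit_D]
  and counit_D_pure = tensor_bilinear.tensor_lift_pure[OF counit_D_bilinear, folded counit_D]

lemma antipode_D: "antipode D = tensor_lift k T (\<lambda>a x.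
    p \<one>\<^bsub>K\<^esub> (antipode H x) \<otimes>\<^bsub>D\<^esub> p (antipode K a) \<one>\<^bsub>H\<^esub>)"
proof -
  have "antipode D = tensor_lift k (tensor_coalgebra k K H) (\<lambda>a x.
    p \<one>\<^bsub>K\<^esub> (antipode H x) \<otimes>\<^bsub>D\<^esub> p (antipode K a) \<one>\<^bsub>H\<^esub>)"
    by (simp add: double_cross_product_def coalgebra.defs Let_def)
  also have "\<dots> = tensor_lift k T (\<lambda>a x.
    p \<one>\<^bsub>K\<^esub> (antipode H x) \<otimes>\<^bsub>D\<^esub> p (antipode K a) \<one>\<^bsub>H\<^esub>)"
    by (rule tensor_lift_carrier_cong) (simp_all add: tensor_coalgebra_def module.defs Let_def)
  finally show ?thesis .
qed

lemma antipode_D_bilinear: "tensor_bilinear k K H T (\<lambda>a x.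
    p \<one>\<^bsub>K\<^esub> (antipode H x) \<otimes>\<^bsub>D\<^esub> p (antipode K a) \<one>\<^bsub>H\<^esub>)"
  by (intro tensor_bilinear.intro tensor_bilinear_axioms.intro KH.module_pair_axioms
      KH.module_tensor linear_map_bilinear_left[OF bilinear_mult_D]
      linear_map_bilinear_right[OF bilinear_mult_D] lin)

lemmas linear_map_antipode_D =
    tensor_bilinear.linear_map_tensor_lift[OF antipode_D_bilinear, folded antipode_D]
  and antipode_D_pure = tensor_bilinear.tensor_lift_pure[OF antipode_D_bilinear, folded antipode_D]

abbreviation pure_comult where
  "pure_comult a x \<equiv> sweedler k K a TT.T (\<lambda>a1 a2. sweedler k H x TT.T (\<lambda>x1 x2.
     pure_tensor k T T (p a1 x1) (p a2 x2)))"

lemma comult_D: "comult D = tensor_lift k TT.T pure_comult"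
  by (simp add: double_cross_product_def coalgebra.defs tensor_coalgebra_def module.defs Let_def)

lemma comult_D_bilinear: "tensor_bilinear k K H TT.T pure_comult"
  by (intro tensor_bilinear.intro tensor_bilinear_axioms.intro KH.module_pair_axioms lin)

lemmas linear_map_comult_D =
    tensor_bilinear.linear_map_tensor_lift[OF comult_D_bilinear, folded comult_D]
  and comult_D_pure = tensor_bilinear.tensor_lift_pure[OF comult_D_bilinear, folded comult_D]

context
  fixes U and \<beta>
  assumes U: "module k U" and \<beta>: "bilinear_map k T T U \<beta>"
begin

lemma tensor_bilinear_TT: "tensor_bilinear k T T U \<beta>"
  by (intro tensor_bilinear.intro tensor_bilinear_axioms.intro TT.module_pair_axioms U \<beta>)

lemma linear_map_sweedler_D: "linear_map k T U (\<lambda>t. sweedler k D t U \<beta>)"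
  unfolding sweedler_def
  by (rule linear_map_comp[OF linear_map_comult_D
      tensor_bilinear.linear_map_tensor_lift[OF tensor_bilinear_TT]])

text \<open>Splitting \<open>a \<otimes> x\<close> amounts to splitting \<open>a\<close> and
  \<open>x\<close> independently; the lift of \<open>\<beta>\<close> is carried through both sums of
  the tensor comultiplication.\<close>

lemma sweedler_D_pure:
  assumes "a \<in> carrier K" "x \<in> carrier H"
  shows "sweedler k D (p a x) U \<beta> =
    sweedler k K a U (\<lambda>a1 a2. sweedler k H x U (\<lambda>x1 x2. \<beta> (p a1 x1) (p a2 x2)))"
proof -
  have "sweedler k D (p a x) U \<beta> = tensor_lift k U \<beta> (pure_comult a x)"
    using assms by (simp add: sweedler_def[of k D] comult_D_pure)
  also have "\<dots> = sweedler k K a U (\<lambda>a1 a2. sweedler k H x U (\<lambda>x1 x2. \<beta> (p a1 x1) (p a2 x2)))"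
    using assms
    by (intro sweedler_sweedler_map K.coalgebra_axioms H.coalgebra_axioms U lin
        tensor_bilinear.linear_map_tensor_lift[OF tensor_bilinear_TT]
        tensor_bilinear.tensor_lift_pure[OF tensor_bilinear_TT])
  finally show ?thesis .
qed

end

abbreviation compatible where
  "compatible \<pi> \<equiv> (\<forall>a\<in>carrier K. \<forall>x\<in>carrier H. sweedler k H x H (\<lambda>x1 x2. sweedler k K a H (\<lambda>a1 a2.
     \<pi> (x1 \<rightharpoonup> a1) \<otimes>\<^bsub>H\<^esub> (x2 \<leftharpoonup> a2))) = x \<otimes>\<^bsub>H\<^esub> \<pi> a)"

section \<open>From a retraction to a compatible homomorphism\<close>

lemma hopf_hom_of_retraction:
  assumes \<theta>: "hopf_hom k D H \<theta>" and ret: "\<And>x. x \<in> carrier H \<Longrightarrow> \<theta> (p \<one>\<^bsub>K\<^esub> x) = x"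
  defines "\<pi> \<equiv> \<lambda>a. \<theta> (p a \<one>\<^bsub>H\<^esub>)"
  shows "hopf_hom k K H \<pi>" and "compatible \<pi>"
proof -
  interpret HH: module_pair k H H by (rule H.module_pair_self)
  note [simp] = closed
  have \<theta>_ring: "\<theta> \<in> ring_hom D H" and \<theta>_lin: "linear_map k T H \<theta>"
    using \<theta> by (auto simp: hopf_hom_def coalgebra_hom_def linear_map_D)
  have \<theta>_mult: "\<theta> (s \<otimes>\<^bsub>D\<^esub> t) = \<theta> s \<otimes>\<^bsub>H\<^esub> \<theta> t" if "s \<in> carrier T" "t \<in> carrier T" for s t
    using ring_hom_mult[OF \<theta>_ring] that by simp
  have \<theta>_closed: "\<theta> t \<in> carrier H" if "t \<in> carrier T" for t
    by (rule linear_map_closed[OF \<theta>_lin that])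
  have \<pi>_lin: "linear_map k K H \<pi>"
    unfolding \<pi>_def by (intro linear_map_comp[OF _ \<theta>_lin] lin)
  note \<pi>_closed = linear_map_closed[OF \<pi>_lin]
  note \<theta>_intros = linear_map_comp[OF _ \<theta>_lin] \<theta>_closed HH.module_tensor
    linear_map_bilinear_left[OF HH.bilinear_map_pure_tensor]
    linear_map_bilinear_right[OF HH.bilinear_map_pure_tensor]
  show "hopf_hom k K H \<pi>"
    unfolding hopf_hom_def coalgebra_hom_def
  proof (intro conjI ballI)
    show "\<pi> \<in> ring_hom K H"
    proof (rule ring_hom_memI)
      fix a b assume ab: "a \<in> carrier K" "b \<in> carrier K"
      then show "\<pi> (a \<otimes>\<^bsub>K\<^esub> b) = \<pi> a \<otimes>\<^bsub>H\<^esub> \<pi> b"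
        using \<theta>_mult[of "p a \<one>\<^bsub>H\<^esub>" "p b \<one>\<^bsub>H\<^esub>"] by (simp add: \<pi>_def mult_D_pure_one_left)
      show "\<pi> (a \<oplus>\<^bsub>K\<^esub> b) = \<pi> a \<oplus>\<^bsub>H\<^esub> \<pi> b"
        by (rule linear_map_add[OF \<pi>_lin ab])
    qed (simp_all add: \<pi>_def ret \<theta>_closed)
    show "linear_map k K H \<pi>" by (rule \<pi>_lin)
    fix a assume a: "a \<in> carrier K"
    have "comult H (\<pi> a) = sweedler k D (p a \<one>\<^bsub>H\<^esub>) HH.T (\<lambda>s t. pure_tensor k H H (\<theta> s) (\<theta> t))"
      using \<theta> a by (simp add: hopf_hom_def coalgebra_hom_def \<pi>_def)
    also have "\<dots> = sweedler k K a HH.T (\<lambda>a1 a2. sweedler k H \<one>\<^bsub>H\<^esub> HH.T (\<lambda>x1 x2.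
        pure_tensor k H H (\<theta> (p a1 x1)) (\<theta> (p a2 x2))))"
      using a by (intro sweedler_D_pure lin \<theta>_intros)
    \<comment> \<open>The sum over the legs of the unit has one term, which leaves
      \<open>a1 \<otimes> 1\<close> and \<open>a2 \<otimes> 1\<close>.\<close>
    also have "\<dots> = sweedler k K a HH.T (\<lambda>a1 a2. pure_tensor k H H (\<pi> a1) (\<pi> a2))"
      unfolding \<pi>_def using a by (intro K.sweedler_cong H.sweedler_one lin \<theta>_intros)
    finally show "comult H (\<pi> a) = \<dots>" .
    show "counit H (\<pi> a) = counit K a"
      using \<theta> a by (simp add: hopf_hom_def coalgebra_hom_def \<pi>_def counit_D_pure H.counit_one
          K.counit_closed)
    \<comment> \<open>As \<open>S 1 = 1\<close>, the antipode formula reduces to the unit times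
      \<open>S a \<otimes> 1\<close>.\<close>
    have "antipode D (p a \<one>\<^bsub>H\<^esub>) = p (antipode K a) \<one>\<^bsub>H\<^esub>"
      using a by (simp add: antipode_D_pure H.antipode_one mult_D_pure_one_left)
    then show "\<pi> (antipode K a) = antipode H (\<pi> a)"
      using \<theta> a unfolding hopf_hom_def \<pi>_def by (metis D_simps(1) H.one_closed KH.pure_tensor_closed)
  qed
  show "compatible \<pi>"
  proof (intro ballI)
    fix a x assume a: "a \<in> carrier K" and x: "x \<in> carrier H"
    have "x \<otimes>\<^bsub>H\<^esub> \<pi> a = \<theta> (p \<one>\<^bsub>K\<^esub> x \<otimes>\<^bsub>D\<^esub> p a \<one>\<^bsub>H\<^esub>)"
      using a x by (simp add: \<theta>_mult ret \<pi>_def)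
    also have "\<dots> = \<theta> (pure_mult \<one>\<^bsub>K\<^esub> x a \<one>\<^bsub>H\<^esub>)"
      using a x by (simp add: mult_D_pure)
    also have "\<dots> = sweedler k H x H (\<lambda>x1 x2. sweedler k K a H (\<lambda>a1 a2.
        \<pi> (x1 \<rightharpoonup> a1) \<otimes>\<^bsub>H\<^esub> (x2 \<leftharpoonup> a2)))"
      unfolding pure_mult_def
    proof (rule sweedler_sweedler_map[OF H.coalgebra_axioms K.coalgebra_axioms _ _ \<theta>_lin x a])
      fix x1 x2 a1 a2
      assume xs: "x1 \<in> carrier H" "x2 \<in> carrier H" and as: "a1 \<in> carrier K" "a2 \<in> carrier K"
      let ?b = "x1 \<rightharpoonup> a1" and ?y = "x2 \<leftharpoonup> a2"
      have "\<theta> (p ?b ?y) = \<theta> (p ?b \<one>\<^bsub>H\<^esub> \<otimes>\<^bsub>D\<^esub> p \<one>\<^bsub>K\<^esub> ?y)"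
        using xs as by (simp add: mult_D_pure_one_left)
      also have "\<dots> = \<pi> ?b \<otimes>\<^bsub>H\<^esub> ?y"
        unfolding \<pi>_def using xs as by (simp add: \<theta>_mult ret)
      finally show "\<theta> (p (\<one>\<^bsub>K\<^esub> \<otimes>\<^bsub>K\<^esub> ?b) (?y \<otimes>\<^bsub>H\<^esub> \<one>\<^bsub>H\<^esub>)) = \<pi> ?b \<otimes>\<^bsub>H\<^esub> ?y"
        using xs as by simp
    qed (intro lin; assumption)+
    finally show "sweedler k H x H (\<lambda>x1 x2. sweedler k K a H (\<lambda>a1 a2.
        \<pi> (x1 \<rightharpoonup> a1) \<otimes>\<^bsub>H\<^esub> (x2 \<leftharpoonup> a2))) = x \<otimes>\<^bsub>H\<^esub> \<pi> a"
      by simp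
  qed
qed

section \<open>From a compatible homomorphism to a retraction\<close>

text \<open>\<open>\<theta>\<close> is \<open>\<pi> \<otimes> id\<close> followed by multiplication
  in \<open>H\<close>. It is a coalgebra map because \<open>\<pi>\<close> is one and the
  multiplication of a bialgebra is one.\<close>

lemma retraction_of_hopf_hom:
  assumes \<pi>: "hopf_hom k K H \<pi>" and comp: "compatible \<pi>"
  defines "\<theta> \<equiv> tensor_lift k H (\<lambda>a x. \<pi> a \<otimes>\<^bsub>H\<^esub> x)"
  shows "hopf_hom k D H \<theta>" and "\<And>x. x \<in> carrier H \<Longrightarrow> \<theta> (p \<one>\<^bsub>K\<^esub> x) = x"
proof -
  interpret HH: module_pair k H H by (rule H.module_pair_self)
  note [simp] = closed
  have \<pi>_ring: "\<pi> \<in> ring_hom K H" and \<pi>_co: "coalgebra_hom k K H \<pi>" and \<pi>_lin: "linear_map k K H \<pi>"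
    using \<pi> by (auto simp: hopf_hom_def coalgebra_hom_def)
  note \<pi>_closed [simp] = linear_map_closed[OF \<pi>_lin]
  note \<pi>_intros = linear_map_comp[OF _ \<pi>_lin] \<pi>_closed lin
  interpret \<theta>: tensor_bilinear k K H H "\<lambda>a x. \<pi> a \<otimes>\<^bsub>H\<^esub> x"
    by (intro tensor_bilinear.intro tensor_bilinear_axioms.intro KH.module_pair_axioms \<pi>_intros)
  note \<theta>_lin = \<theta>.linear_map_tensor_lift[folded \<theta>_def]
    and \<theta>_pure [simp] = \<theta>.tensor_lift_pure[folded \<theta>_def]
  note \<theta>_closed [simp] = linear_map_closed[OF \<theta>_lin]
  note \<theta>_intros = linear_map_comp[OF _ \<theta>_lin] \<theta>_closed HH.module_tensor
    linear_map_bilinear_left[OF HH.bilinear_map_pure_tensor]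
    linear_map_bilinear_right[OF HH.bilinear_map_pure_tensor]
    linear_map_bilinear_left[OF bilinear_mult_D] linear_map_bilinear_right[OF bilinear_mult_D]
    linear_map_closed[OF bilinear_map_left[OF bilinear_mult_D]]
  note eqI = tensor_linear_eqI[OF K.module_axioms H.module_axioms]
  show ret: "\<theta> (p \<one>\<^bsub>K\<^esub> x) = x" if "x \<in> carrier H" for x
    using that by (simp add: ring_hom_one[OF \<pi>_ring])
  have \<theta>_pure_mult: "\<theta> (pure_mult a x b y) = (\<pi> a \<otimes>\<^bsub>H\<^esub> x) \<otimes>\<^bsub>H\<^esub> (\<pi> b \<otimes>\<^bsub>H\<^esub> y)"
    if ab: "a \<in> carrier K" "b \<in> carrier K" and xy: "x \<in> carrier H" "y \<in> carrier H" for a x b y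
  proof -
    \<comment> \<open>After reassociation the integrand is \<open>\<pi> a (\<pi> (x1
      \<rightharpoonup> b1) (x2 \<leftharpoonup> b2)) y\<close>. The linear map \<open>?f\<close>
      carries the outer factors, so pulling it out exposes exactly the left side of the
      compatibility condition.\<close>
    let ?f = "\<lambda>u. \<pi> a \<otimes>\<^bsub>H\<^esub> (u \<otimes>\<^bsub>H\<^esub> y)"
    have f: "linear_map k H H ?f" using ab xy by (intro \<pi>_intros)
    have "\<theta> (pure_mult a x b y) = sweedler k H x H (\<lambda>x1 x2. sweedler k K b H (\<lambda>b1 b2.
        ?f (\<pi> (x1 \<rightharpoonup> b1) \<otimes>\<^bsub>H\<^esub> (x2 \<leftharpoonup> b2))))"
      unfolding pure_mult_def
      using ab xy
      by (intro sweedler_sweedler_map H.coalgebra_axioms K.coalgebra_axioms \<theta>_lin lin)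
        (simp_all add: ring_hom_mult[OF \<pi>_ring] H.m_assoc)
    also have "\<dots> = ?f (sweedler k H x H (\<lambda>x1 x2. sweedler k K b H (\<lambda>b1 b2.
        \<pi> (x1 \<rightharpoonup> b1) \<otimes>\<^bsub>H\<^esub> (x2 \<leftharpoonup> b2))))"
      by (rule sweedler_sweedler_map[OF H.coalgebra_axioms K.coalgebra_axioms _ _ f xy(1) ab(2) _ _ refl,
          symmetric]; intro \<pi>_intros; assumption)
    also have "\<dots> = (\<pi> a \<otimes>\<^bsub>H\<^esub> x) \<otimes>\<^bsub>H\<^esub> (\<pi> b \<otimes>\<^bsub>H\<^esub> y)"
      using comp ab xy by (simp add: H.m_assoc)
    finally show ?thesis .
  qed
  have \<theta>_mult: "\<theta> (s \<otimes>\<^bsub>D\<^esub> t) = \<theta> s \<otimes>\<^bsub>H\<^esub> \<theta> t" if s: "s \<in> carrier T" and t: "t \<in> carrier T" for s t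
  proof (rule eqI[OF _ _ _ t])
    show "linear_map k T H (\<lambda>t. \<theta> (s \<otimes>\<^bsub>D\<^esub> t))" "linear_map k T H (\<lambda>t. \<theta> s \<otimes>\<^bsub>H\<^esub> \<theta> t)"
      by (use s in \<open>intro \<theta>_intros lin; assumption\<close>)+
    fix b y assume b: "b \<in> carrier K" and y: "y \<in> carrier H"
    show "\<theta> (s \<otimes>\<^bsub>D\<^esub> p b y) = \<theta> s \<otimes>\<^bsub>H\<^esub> \<theta> (p b y)"
    proof (rule eqI[OF _ _ _ s])
      show "linear_map k T H (\<lambda>s. \<theta> (s \<otimes>\<^bsub>D\<^esub> p b y))"
        using b y by (intro \<theta>_intros lin)
      show "linear_map k T H (\<lambda>s. \<theta> s \<otimes>\<^bsub>H\<^esub> \<theta> (p b y))"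
        using b y by (intro \<theta>_intros lin)
    qed (simp add: mult_D_pure \<theta>_pure_mult b y)
  qed
  show "hopf_hom k D H \<theta>"
    unfolding hopf_hom_def coalgebra_hom_def linear_map_D
  proof (intro conjI ballI)
    show "\<theta> \<in> ring_hom D H"
      by (rule ring_hom_memI)
        (simp_all add: \<theta>_mult linear_map_add[OF \<theta>_lin] ring_hom_one[OF \<pi>_ring])
    show "linear_map k T H \<theta>" by (rule \<theta>_lin)
    fix t assume "t \<in> carrier D"
    then have t: "t \<in> carrier T" by simp
    let ?\<beta> = "\<lambda>s t. pure_tensor k H H (\<theta> s) (\<theta> t)"
    have \<beta>: "bilinear_map k T T HH.T ?\<beta>" by (intro \<theta>_intros lin)
    show "comult H (\<theta> t) = sweedler k D t HH.T ?\<beta>"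
    proof (rule eqI[OF _ _ _ t])
      show "linear_map k T HH.T (\<lambda>t. comult H (\<theta> t))"
        by (rule linear_map_comp[OF \<theta>_lin H.comult_linear])
      show "linear_map k T HH.T (\<lambda>t. sweedler k D t HH.T ?\<beta>)"
        by (rule linear_map_sweedler_D[OF HH.module_tensor \<beta>])
      fix a x assume ax: "a \<in> carrier K" "x \<in> carrier H"
      \<comment> \<open>The comultiplication of \<open>\<pi> a \<cdot> x\<close>, seen as a function
        of the legs of \<open>\<pi> a\<close> alone, so that these can be exchanged for the images
        of the legs of \<open>a\<close>.\<close>
      let ?s = "\<lambda>u1 u2. sweedler k H x HH.T (\<lambda>x1 x2. pure_tensor k H H (u1 \<otimes>\<^bsub>H\<^esub> x1) (u2 \<otimes>\<^bsub>H\<^esub> x2))"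
      have s: "bilinear_map k H H HH.T ?s" using ax by (intro \<theta>_intros lin)
      have "comult H (\<theta> (p a x)) = sweedler k H (\<pi> a) HH.T ?s"
        using ax by (simp add: H.comult_mult)
      also have "\<dots> = sweedler k K a HH.T (\<lambda>a1 a2. ?s (\<pi> a1) (\<pi> a2))"
        by (rule sweedler_coalgebra_hom[OF K.coalgebra_axioms H.coalgebra_axioms \<pi>_co
            HH.module_tensor s ax(1)])
      also have "\<dots> = sweedler k K a HH.T (\<lambda>a1 a2. sweedler k H x HH.T (\<lambda>x1 x2.
          ?\<beta> (p a1 x1) (p a2 x2)))"
        by (rule sweedler_sweedler_map[OF K.coalgebra_axioms H.coalgebra_axioms HH.module_tensor
            HH.module_tensor linear_map_ident ax])
          (simp_all, (intro \<theta>_intros \<pi>_intros; assumption)+)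
      also have "\<dots> = sweedler k D (p a x) HH.T ?\<beta>"
        by (rule sweedler_D_pure[OF HH.module_tensor \<beta> ax, symmetric])
      finally show "comult H (\<theta> (p a x)) = sweedler k D (p a x) HH.T ?\<beta>" .
    qed
    show "counit H (\<theta> t) = counit D t"
      using \<pi>_co
      by (intro eqI[OF linear_map_comp[OF \<theta>_lin H.counit_linear] linear_map_counit_D _ t])
        (simp add: counit_D_pure H.counit_mult coalgebra_hom_def)
    \<comment> \<open>On \<open>a \<otimes> x\<close> both sides are
      \<open>S x \<cdot> S (\<pi> a)\<close>: the left because \<open>\<theta>\<close> is
      multiplicative and \<open>\<pi>\<close> commutes with antipodes, the right by
      \<open>antipode_mult\<close>.\<close>
    show "\<theta> (antipode D t) = antipode H (\<theta> t)"
      by (rule eqI[OF linear_map_comp[OF linear_map_antipode_D \<theta>_lin]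
            linear_map_comp[OF \<theta>_lin H.antipode_linear] _ t])
        (use \<pi> in \<open>simp add: antipode_D_pure \<theta>_mult H.antipode_mult ret ring_hom_one[OF \<pi>_ring]
          hopf_hom_def\<close>)
  qed
qed

end

theorem proposition3p4:
  fixes k :: "('k, 'm) ring_scheme"
    and H :: "('k, 'h, 'n) hopf_algebra_scheme"
    and K :: "('k, 'a, 'o) hopf_algebra_scheme"
    and lact :: "'h \<Rightarrow> 'a \<Rightarrow> 'a" (infixr \<open>\<rightharpoonup>\<close> 75)
    and ract :: "'h \<Rightarrow> 'a \<Rightarrow> 'h" (infixl \<open>\<leftharpoonup>\<close> 75)
  assumes "matched_pair k H K lact ract"
  shows "(\<exists>\<theta>. hopf_hom k (double_cross_product k H K lact ract) H \<theta> \<and>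
              (\<forall>x\<in>carrier H. \<theta> (double_cross_inclusion k H K x) = x))
     \<longleftrightarrow> (\<exists>\<pi>. hopf_hom k K H \<pi> \<and>
              (\<forall>a\<in>carrier K. \<forall>x\<in>carrier H.
                 sweedler k H x H (\<lambda>x1 x2. sweedler k K a H (\<lambda>a1 a2.
                   \<pi> (x1 \<rightharpoonup> a1) \<otimes>\<^bsub>H\<^esub> (x2 \<leftharpoonup> a2))) = x \<otimes>\<^bsub>H\<^esub> \<pi> a))"
proof -
  interpret matched_pair k H K lact ract by fact
  show ?thesis
    unfolding double_cross_inclusion_def
    using hopf_hom_of_retraction retraction_of_hopf_hom by blast
qed

end
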